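(* Suppose that $M_z\in L(H_K)^d$ is an essentially normal $K$-contraction. Let $H,\mathscr{E}_1,\mathscr{E}_2$ be complex Hilbert spaces and let $T\in L(H)^d$ be a commuting tuple. If $j_i\colon H\to H_K(\mathscr{E}_i)$ $(i=1,2)$ are two minimal $K$-dilations of $T$, then there is a unitary operator $U\in L(\mathscr{E}_1,\mathscr{E}_2)$ such that $j_2=(1_{H_K}\otimes U)j_1$.
   Context: Let $d\ge 1$, let $\mathbb{B}_d$ be the open Euclidean unit ball of $\mathbb{C}^d$ and $\mathbb{D}$ the open unit disc. Let $k\colon\mathbb{D}\to\mathbb{C}$, $k(z)=\sum_{n=0}^\infty a_nz^n$, be an analytic function without zeros such that $a_0=1$, $a_n>0$ for all $n$ and $0<\inf_n \frac{a_n}{a_{n+1}}\le\sup_n\frac{a_n}{a_{n+1}}<\infty$. Write $\frac1k(z)=\sum_{n=0}^\infty c_nz^n$ on $\mathbb{D}$ and $K(z,w)=k(\langle z,w\rangle)$ for $z,w\in\mathbb{B}_d$. For a complex Hilbert space $\mathscr{E}$, $H_K(\mathscr{E})$ is the $\mathscr{E}$-valued functional Hilbert space on $\mathbb{B}_d$ with reproducing kernel $(z,w)\mapsto K(z,w)1_{\mathscr{E}}$, and $H_K=H_K(\mathbb{C})$; $H_K(\mathscr{E})$ is identified with the Hilbert space tensor product $H_K\otimes\mathscr{E}$, so that $((1_{H_K}\otimes U)f)(z)=U(f(z))$. $M_z=(M_{z_1},\dots,M_{z_d})$ is the (bounded) tuple of multiplications by the coordinate functions on $H_K$ or $H_K(\mathscr{E})$.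 $L(H,G)$ denotes the bounded linear operators from $H$ to $G$. For a commuting tuple $T=(T_1,\dots,T_d)\in L(H)^d$ let $\sigma_T(X)=\sum_{i=1}^dT_iXT_i^*$. $T$ is a $K$-contraction if the limit $\frac1K(T)=\text{SOT-}\sum_{n=0}^\infty c_n\sigma_T^n(1_H)$ exists and is a positive operator. $T$ is essentially normal if $T_iT_i^*-T_i^*T_i$ is compact for $i=1,\dots,d$. A $K$-dilation of a commuting tuple $T\in L(H)^d$ is an isometric linear map $j\colon H\to H_K(\mathscr{E})$ ($\mathscr{E}$ a Hilbert space) with $jT_i^*=M_{z_i}^*j$ for $i=1,\dots,d$. It is minimal if the only closed subspace of $H_K(\mathscr{E})$ that is reducing for $M_z\in L(H_K(\mathscr{E}))^d$ and contains $\operatorname{Im}j$ is $H_K(\mathscr{E})$ itself. *)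

theory Defs
  imports "HOL-Analysis.Analysis" "HOL-Library.Function_Algebras"
begin

section \<open>Complex vector spaces\<close>

class complex_vector = ab_group_add +
  fixes scaleC :: "complex \<Rightarrow> 'a \<Rightarrow> 'a"  (infixr "*\<^sub>C" 75)
  assumes scaleC_add_right: "c *\<^sub>C (x + y) = c *\<^sub>C x + c *\<^sub>C y"
    and scaleC_add_left: "(b + c) *\<^sub>C x = b *\<^sub>C x + c *\<^sub>C x"
    and scaleC_scaleC: "b *\<^sub>C c *\<^sub>C x = (b * c) *\<^sub>C x"
    and scaleC_one: "1 *\<^sub>C x = x"

instantiation complex :: complex_vector
begin
definition scaleC_complex_def: "c *\<^sub>C (x::complex) = c * x"
instance by standard (simp_all add: scaleC_complex_def algebra_simps)
end

instantiation "fun" :: (type, complex_vector) complex_vector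
begin
definition scaleC_fun_def: "c *\<^sub>C f = (\<lambda>x. c *\<^sub>C f x)"
instance
  by standard (simp_all add: scaleC_fun_def fun_eq_iff scaleC_add_right scaleC_add_left
      scaleC_scaleC scaleC_one)
end

section \<open>Hilbert spaces and operators\<close>

text \<open>A Hilbert space is a linear subspace of an ambient complex vector space together with an
  inner product, linear in the first argument, whose values matter on the carrier only. Explicit
  carriers are needed because the functional Hilbert spaces below depend on the kernel. Operators
  are functions on the ambient types; again only their values on the carrier matter.\<close>

record 'a hspace =
  carr :: "'a set"
  ip :: "'a \<Rightarrow> 'a \<Rightarrow> complex"

definition csubspace :: "'a::complex_vector set \<Rightarrow> bool" where
  "csubspace S \<longleftrightarrow> 0 \<in> S \<and> (\<forall>x\<in>S. \<forall>y\<in>S. x + y \<in> S) \<and> (\<forall>c. \<forall>x\<in>S. c *\<^sub>C x \<in> S)"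

definition hnorm :: "'a hspace \<Rightarrow> 'a \<Rightarrow> real" where
  "hnorm V x = sqrt (Re (ip V x x))"

text \<open>The value 0 off the carrier is needed because \<open>Metric_space\<close> demands
  nonnegativity and symmetry on the whole type.\<close>

definition hdist :: "'a::complex_vector hspace \<Rightarrow> 'a \<Rightarrow> 'a \<Rightarrow> real" where
  "hdist V x y = (if x \<in> carr V \<and> y \<in> carr V then hnorm V (x - y) else 0)"

abbreviation htopology :: "'a::complex_vector hspace \<Rightarrow> 'a topology" where
  "htopology V \<equiv> Metric_space.mtopology (carr V) (hdist V)"

definition inner_product_space :: "'a::complex_vector hspace \<Rightarrow> bool" where
  "inner_product_space V \<longleftrightarrow> csubspace (carr V)
     \<and> (\<forall>x\<in>carr V. \<forall>y\<in>carr V. \<forall>z\<in>carr V. ip V (x + y) z = ip V x z + ip V y z)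
     \<and> (\<forall>c. \<forall>x\<in>carr V. \<forall>y\<in>carr V. ip V (c *\<^sub>C x) y = c * ip V x y)
     \<and> (\<forall>x\<in>carr V. \<forall>y\<in>carr V. ip V y x = cnj (ip V x y))
     \<and> (\<forall>x\<in>carr V. 0 \<le> Re (ip V x x) \<and> (ip V x x = 0 \<longrightarrow> x = 0))"

lemma Metric_space_hdist:
  assumes "inner_product_space V"
  shows "Metric_space (carr V) (hdist V)"
proof -
  have z: "(0::complex) *\<^sub>C v = 0" and m: "(-1) *\<^sub>C v = - v" for v :: 'a
  proof -
    have "(0 + 0::complex) *\<^sub>C v = 0 *\<^sub>C v + 0 *\<^sub>C v"
      by (rule scaleC_add_left)
    then show 0: "(0::complex) *\<^sub>C v = 0"
      by simp
    have "(-1) *\<^sub>C v + v = (-1 + 1) *\<^sub>C v"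
      by (simp only: scaleC_add_left scaleC_one)
    then show "(-1) *\<^sub>C v = - v"
      using 0 by (simp add: eq_neg_iff_add_eq_0)
  qed
  note V = assms[unfolded inner_product_space_def csubspace_def]
  have S: "0 \<in> carr V" "\<And>x y. x \<in> carr V \<Longrightarrow> y \<in> carr V \<Longrightarrow> x + y \<in> carr V"
    "\<And>c x. x \<in> carr V \<Longrightarrow> c *\<^sub>C x \<in> carr V"
    using V by simp_all
  have add: "ip V (x + y) z = ip V x z + ip V y z"
    if "x \<in> carr V" "y \<in> carr V" "z \<in> carr V" for x y z
    using V that by meson
  have scl: "ip V (c *\<^sub>C x) y = c * ip V x y" if "x \<in> carr V" "y \<in> carr V" for c x y
    using V that by meson
  have cnj: "ip V y x = cnj (ip V x y)" if "x \<in> carr V" "y \<in> carr V" for x y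
    using V that by meson
  have pos: "0 \<le> Re (ip V x x)" if "x \<in> carr V" for x
    using V that by meson
  have dfn: "x = 0" if "x \<in> carr V" "ip V x x = 0" for x
    using V that by meson
  have diff: "x - y \<in> carr V" if "x \<in> carr V" "y \<in> carr V" for x y
    using S(2)[OF that(1) S(3)[OF that(2), of "-1"]] by (simp add: m)
  have addr: "ip V z (x + y) = ip V z x + ip V z y"
    if "x \<in> carr V" "y \<in> carr V" "z \<in> carr V" for x y z
    using that add[OF that] cnj[of "x + y" z] cnj[of x z] cnj[of y z] S(2)[OF that(1,2)] by simp
  have sclr: "ip V y (c *\<^sub>C x) = cnj c * ip V y x" if "x \<in> carr V" "y \<in> carr V" for c x y
    using scl[OF that, of c] cnj[of "c *\<^sub>C x" y] cnj[of x y] S(3) that by simp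
  have sym: "hnorm V (x - y) = hnorm V (y - x)" if "x \<in> carr V" "y \<in> carr V" for x y
  proof -
    have "ip V ((-1) *\<^sub>C (x - y)) ((-1) *\<^sub>C (x - y)) = ip V (x - y) (x - y)"
      using diff[OF that] by (simp only: scl sclr S(3)) simp
    then show ?thesis
      by (simp add: m hnorm_def)
  qed
  have im0: "Im (ip V x x) = 0" if "x \<in> carr V" for x
    using cnj[OF that that] by (simp add: complex_eq_iff)
  have tri: "hnorm V (x + y) \<le> hnorm V x + hnorm V y" if xy: "x \<in> carr V" "y \<in> carr V" for x y
  proof -
    define b where "b = Re (ip V x y)"
    have q: "0 \<le> t\<^sup>2 * Re (ip V x x) + 2 * s * t * b + s\<^sup>2 * Re (ip V y y)" for s t :: real
    proof -
      have "Re (ip V (of_real t *\<^sub>C x + of_real s *\<^sub>C y) (of_real t *\<^sub>C x + of_real s *\<^sub>C y))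
        = t\<^sup>2 * Re (ip V x x) + 2 * s * t * b + s\<^sup>2 * Re (ip V y y)"
        using xy cnj[OF xy] by (simp add: add addr scl sclr S b_def power2_eq_square algebra_simps)
      moreover have "of_real t *\<^sub>C x + of_real s *\<^sub>C y \<in> carr V"
        using xy by (intro S)
      ultimately show ?thesis using pos[of "of_real t *\<^sub>C x + of_real s *\<^sub>C y"] by simp
    qed
    have cs: "b \<le> hnorm V x * hnorm V y"
    proof (cases "Re (ip V x x) = 0 \<or> Re (ip V y y) = 0")
      case True
      then have "x = 0 \<or> y = 0"
        using dfn[OF xy(1)] dfn[OF xy(2)] im0[OF xy(1)] im0[OF xy(2)]
        by (auto simp: complex_eq_iff)
      then have "b = 0"
        using scl[OF xy, of 0] sclr[OF xy(2,1), of 0] by (auto simp: b_def z)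
      with pos[OF xy(1)] pos[OF xy(2)] show ?thesis by (simp add: hnorm_def)
    next
      case False
      define p r where "p = hnorm V x" and "r = hnorm V y"
      have pr: "0 < p" "0 < r" "p\<^sup>2 = Re (ip V x x)" "r\<^sup>2 = Re (ip V y y)"
        using False pos[OF xy(1)] pos[OF xy(2)] by (auto simp: p_def r_def hnorm_def)
      have "0 \<le> r\<^sup>2 * p\<^sup>2 + 2 * (- p) * r * b + (- p)\<^sup>2 * r\<^sup>2"
        using q[of r "- p"] pr by simp
      then have "0 \<le> (2 * p * r) * (p * r - b)"
        by (simp add: algebra_simps power2_eq_square)
      moreover have "0 < 2 * p * r"
        using pr by simp
      ultimately have "0 \<le> p * r - b"
        by (metis zero_le_mult_iff not_le)
      then show ?thesis by (simp add: p_def r_def)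
    qed
    have "Re (ip V (x + y) (x + y)) = Re (ip V x x) + 2 * b + Re (ip V y y)"
      using xy cnj[OF xy] by (simp add: add addr S b_def)
    also have "\<dots> \<le> (hnorm V x + hnorm V y)\<^sup>2"
      using cs pos[OF xy(1)] pos[OF xy(2)] by (simp add: hnorm_def power2_sum)
    finally show ?thesis
      unfolding hnorm_def[of V "x + y"] using pos[OF xy(1)] pos[OF xy(2)]
      by (intro real_le_lsqrt) (auto simp: hnorm_def)
  qed
  show ?thesis
  proof
    show "0 \<le> hdist V x y" for x y
      using pos diff by (simp add: hdist_def hnorm_def)
    show "hdist V x y = hdist V y x" for x y
      using sym by (simp add: hdist_def)
    show "hdist V x y = 0 \<longleftrightarrow> x = y" if xy: "x \<in> carr V" "y \<in> carr V" for x y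
      using xy dfn[OF diff[OF xy]] im0[OF diff[OF xy]] scl[OF S(1) S(1), of 0]
      by (auto simp: hdist_def hnorm_def complex_eq_iff z)
    show "hdist V x w \<le> hdist V x y + hdist V y w"
      if "x \<in> carr V" "y \<in> carr V" "w \<in> carr V" for x y w
      using tri[OF diff diff, of x y y w] that by (simp add: hdist_def)
  qed
qed

definition hilbert_space :: "'a::complex_vector hspace \<Rightarrow> bool" where
  "hilbert_space V \<longleftrightarrow> inner_product_space V \<and> Metric_space.mcomplete (carr V) (hdist V)"

definition complex_hspace :: "complex hspace" where
  "complex_hspace = \<lparr>carr = UNIV, ip = (\<lambda>x y. x * cnj y)\<rparr>"

lemma hilbert_space_complex_hspace: "hilbert_space complex_hspace"
proof -
  have "hnorm complex_hspace u = norm u" for u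
    by (simp add: hnorm_def complex_hspace_def cmod_def power2_eq_square)
  then have d: "hdist complex_hspace = dist"
    by (intro ext) (simp add: hdist_def complex_hspace_def dist_norm)
  have "Metric_space.mcomplete (UNIV::complex set) dist"
    using complete_UNIV by simp
  moreover have "inner_product_space complex_hspace"
    by (auto simp: inner_product_space_def csubspace_def complex_hspace_def scaleC_complex_def
        algebra_simps)
  ultimately show ?thesis
    unfolding hilbert_space_def d by (simp add: complex_hspace_def)
qed

definition linear_op ::
    "'a::complex_vector hspace \<Rightarrow> 'b::complex_vector hspace \<Rightarrow> ('a \<Rightarrow> 'b) \<Rightarrow> bool" where
  "linear_op V W A \<longleftrightarrow> (\<forall>x\<in>carr V. A x \<in> carr W)
     \<and> (\<forall>x\<in>carr V. \<forall>y\<in>carr V. A (x + y) = A x + A y)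
     \<and> (\<forall>c. \<forall>x\<in>carr V. A (c *\<^sub>C x) = c *\<^sub>C A x)"

definition bounded_op ::
    "'a::complex_vector hspace \<Rightarrow> 'b::complex_vector hspace \<Rightarrow> ('a \<Rightarrow> 'b) \<Rightarrow> bool" where
  "bounded_op V W A \<longleftrightarrow> linear_op V W A \<and> (\<exists>B. \<forall>x\<in>carr V. hnorm W (A x) \<le> B * hnorm V x)"

definition isometric_op ::
    "'a::complex_vector hspace \<Rightarrow> 'b::complex_vector hspace \<Rightarrow> ('a \<Rightarrow> 'b) \<Rightarrow> bool" where
  "isometric_op V W A \<longleftrightarrow> linear_op V W A \<and> (\<forall>x\<in>carr V. hnorm W (A x) = hnorm V x)"

definition unitary_op ::
    "'a::complex_vector hspace \<Rightarrow> 'b::complex_vector hspace \<Rightarrow> ('a \<Rightarrow> 'b) \<Rightarrow> bool" where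
  "unitary_op V W U \<longleftrightarrow> isometric_op V W U \<and> U ` carr V = carr W"

text \<open>By the Riesz theorem this is well defined on the carrier for bounded operators between
  Hilbert spaces.\<close>

definition adj :: "'a hspace \<Rightarrow> 'b hspace \<Rightarrow> ('a \<Rightarrow> 'b) \<Rightarrow> 'b \<Rightarrow> 'a" where
  "adj V W A y = (THE x. x \<in> carr V \<and> (\<forall>u\<in>carr V. ip W (A u) y = ip V u x))"

definition positive_op :: "'a::complex_vector hspace \<Rightarrow> ('a \<Rightarrow> 'a) \<Rightarrow> bool" where
  "positive_op V P \<longleftrightarrow> bounded_op V V P
     \<and> (\<forall>x\<in>carr V. Im (ip V (P x) x) = 0 \<and> 0 \<le> Re (ip V (P x) x))"

definition compact_op ::
    "'a::complex_vector hspace \<Rightarrow> 'b::complex_vector hspace \<Rightarrow> ('a \<Rightarrow> 'b) \<Rightarrow> bool" where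
  "compact_op V W A \<longleftrightarrow> linear_op V W A
     \<and> compactin (htopology W)
         (htopology W closure_of (A ` {x \<in> carr V. hnorm V x \<le> 1}))"

definition closed_subspace :: "'a::complex_vector hspace \<Rightarrow> 'a set \<Rightarrow> bool" where
  "closed_subspace V M \<longleftrightarrow> csubspace M \<and> closedin (htopology V) M"

section \<open>Operator tuples\<close>

definition commuting_tuple ::
    "'a::complex_vector hspace \<Rightarrow> ('d::finite \<Rightarrow> 'a \<Rightarrow> 'a) \<Rightarrow> bool" where
  "commuting_tuple V T \<longleftrightarrow> (\<forall>i. bounded_op V V (T i))
     \<and> (\<forall>i l. \<forall>x\<in>carr V. T i (T l x) = T l (T i x))"

definition essentially_normal ::
    "'a::complex_vector hspace \<Rightarrow> ('d::finite \<Rightarrow> 'a \<Rightarrow> 'a) \<Rightarrow> bool" where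
  "essentially_normal V T \<longleftrightarrow>
     (\<forall>i. compact_op V V (\<lambda>x. T i (adj V V (T i) x) - adj V V (T i) (T i x)))"

definition sigma ::
    "'a::complex_vector hspace \<Rightarrow> ('d::finite \<Rightarrow> 'a \<Rightarrow> 'a) \<Rightarrow> ('a \<Rightarrow> 'a) \<Rightarrow> 'a \<Rightarrow> 'a" where
  "sigma V T X = (\<lambda>x. \<Sum>i\<in>UNIV. T i (X (adj V V (T i) x)))"

text \<open>The sequence \<open>c\<close> holds the Taylor coefficients of \<open>1/k\<close>.\<close>

definition K_contraction ::
    "(nat \<Rightarrow> complex) \<Rightarrow> 'a::complex_vector hspace \<Rightarrow> ('d::finite \<Rightarrow> 'a \<Rightarrow> 'a) \<Rightarrow> bool" where
  "K_contraction c V T \<longleftrightarrow> commuting_tuple V T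
     \<and> (\<exists>P. positive_op V P
          \<and> (\<forall>x\<in>carr V. limitin (htopology V)
                (\<lambda>N. \<Sum>n<N. c n *\<^sub>C (sigma V T ^^ n) (\<lambda>y. y) x) (P x) sequentially))"

definition reducing ::
    "'a::complex_vector hspace \<Rightarrow> ('d::finite \<Rightarrow> 'a \<Rightarrow> 'a) \<Rightarrow> 'a set \<Rightarrow> bool" where
  "reducing V T M \<longleftrightarrow> (\<forall>i. \<forall>x\<in>M. T i x \<in> M \<and> adj V V (T i) x \<in> M)"

section \<open>The functional Hilbert spaces\<close>

text \<open>\<open>F\<close> is the \<open>E\<close>-valued functional Hilbert space on \<open>X\<close> with reproducing kernel
  \<open>\<kappa>(z,w) 1\<^sub>E\<close>; this determines \<open>F\<close> uniquely (up to values of \<open>ip F\<close> off the carrier).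
  Functions on \<open>X\<close> are represented by functions that vanish outside \<open>X\<close>.\<close>

definition functional_hilbert_space ::
    "'z set \<Rightarrow> ('z \<Rightarrow> 'z \<Rightarrow> complex) \<Rightarrow> 'e::complex_vector hspace \<Rightarrow> ('z \<Rightarrow> 'e) hspace \<Rightarrow> bool" where
  "functional_hilbert_space X \<kappa> E F \<longleftrightarrow> hilbert_space F
     \<and> (\<forall>f\<in>carr F. (\<forall>z\<in>X. f z \<in> carr E) \<and> (\<forall>z. z \<notin> X \<longrightarrow> f z = 0))
     \<and> (\<forall>w\<in>X. \<forall>x\<in>carr E.
          (\<lambda>z. if z \<in> X then \<kappa> z w *\<^sub>C x else 0) \<in> carr F
          \<and> (\<forall>f\<in>carr F. ip F f (\<lambda>z. if z \<in> X then \<kappa> z w *\<^sub>C x else 0) = ip E (f w) x))"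

definition cdot :: "complex^'d \<Rightarrow> complex^'d \<Rightarrow> complex" where
  "cdot z w = (\<Sum>i\<in>UNIV. z $ i * cnj (w $ i))"

text \<open>\<open>F\<close> is \<open>H\<^sub>K(E)\<close> for \<open>K(z,w) = k(\<langle>z,w\<rangle>)\<close>.\<close>

definition is_HK ::
    "(complex \<Rightarrow> complex) \<Rightarrow> 'e::complex_vector hspace \<Rightarrow> (complex^'d \<Rightarrow> 'e) hspace \<Rightarrow> bool" where
  "is_HK k E F \<longleftrightarrow> functional_hilbert_space (ball 0 1) (\<lambda>z w. k (cdot z w)) E F"

definition kernel_function ::
    "(complex \<Rightarrow> complex) \<Rightarrow> (nat \<Rightarrow> real) \<Rightarrow> (nat \<Rightarrow> complex) \<Rightarrow> bool" where
  "kernel_function k a c \<longleftrightarrow> k analytic_on ball 0 1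
     \<and> (\<forall>z\<in>ball 0 1. (\<lambda>n. of_real (a n) * z ^ n) sums k z)
     \<and> (\<forall>z\<in>ball 0 1. k z \<noteq> 0)
     \<and> a 0 = 1 \<and> (\<forall>n. 0 < a n)
     \<and> 0 < (INF n. a n / a (Suc n)) \<and> bdd_above (range (\<lambda>n. a n / a (Suc n)))
     \<and> (\<forall>z\<in>ball 0 1. (\<lambda>n. c n * z ^ n) sums (1 / k z))"

definition Mz :: "'d::finite \<Rightarrow> (complex^'d \<Rightarrow> 'e::complex_vector) \<Rightarrow> complex^'d \<Rightarrow> 'e" where
  "Mz i f = (\<lambda>z. (z $ i) *\<^sub>C f z)"

text \<open>The operator \<open>1 \<otimes> U\<close> under the identification of \<open>H\<^sub>K(E)\<close> with \<open>H\<^sub>K \<otimes> E\<close>.\<close>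

definition id_tensor :: "('e1 \<Rightarrow> 'e2) \<Rightarrow> ('z \<Rightarrow> 'e1) \<Rightarrow> 'z \<Rightarrow> 'e2" where
  "id_tensor U f = (\<lambda>z. U (f z))"

text \<open>In the next two definitions, \<open>F\<close> is meant to be \<open>H\<^sub>K(E)\<close>.\<close>

definition K_dilation ::
    "'h::complex_vector hspace \<Rightarrow> ('d::finite \<Rightarrow> 'h \<Rightarrow> 'h) \<Rightarrow>
     (complex^'d \<Rightarrow> 'e::complex_vector) hspace \<Rightarrow> ('h \<Rightarrow> complex^'d \<Rightarrow> 'e) \<Rightarrow> bool" where
  "K_dilation H T F j \<longleftrightarrow> isometric_op H F j
     \<and> (\<forall>i. \<forall>x\<in>carr H. j (adj H H (T i) x) = adj F F (Mz i) (j x))"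

definition minimal_K_dilation ::
    "'h::complex_vector hspace \<Rightarrow> ('d::finite \<Rightarrow> 'h \<Rightarrow> 'h) \<Rightarrow>
     (complex^'d \<Rightarrow> 'e::complex_vector) hspace \<Rightarrow> ('h \<Rightarrow> complex^'d \<Rightarrow> 'e) \<Rightarrow> bool" where
  "minimal_K_dilation H T F j \<longleftrightarrow> K_dilation H T F j
     \<and> (\<forall>M. closed_subspace F M \<and> reducing F Mz M \<and> j ` carr H \<subseteq> M \<longrightarrow> M = carr F)"

end

theory Submission
  imports Defs
begin

text \<open>A \<open>K\<close>-dilation \<open>j\<close> is determined by the map \<open>\<Gamma> x = (j x)(0)\<close>: the scalar functions
  \<open>\<langle>(j x)(\<cdot>), e\<rangle>\<close> (slices) lie in \<open>H\<^sub>K\<close>, their orthogonality to monomials is expressed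
  by \<open>\<Gamma>\<close> and the \<open>T\<^sub>i\<^sup>*\<close>, and the polynomials are dense in \<open>H\<^sub>K\<close> since \<open>\<Sum>n. a\<^sub>n \<sigma>\<^sup>n(P) = 1\<close>
  weakly, \<open>P\<close> being the projection onto the constants. Moreover \<open>\<Gamma>\<^sup>*\<Gamma> = \<Sum>n. c\<^sub>n \<sigma>\<^sub>T\<^sup>n(1)\<close>
  depends on \<open>T\<close> only: on \<open>H\<^sub>K\<close> the partial sums of \<open>\<Sum>n. c\<^sub>n \<sigma>\<^sup>n(1)\<close> are uniformly bounded by the
  Banach-Steinhaus theorem and converge to \<open>P\<close> on kernel functions; the bounds carry over from
  \<open>H\<^sub>K\<close> to \<open>H\<^sub>K(E)\<close> since they say that certain kernels are positive semidefinite, a property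
  preserved by Schur products with Gram matrices. Finally, the functions whose values are
  orthogonal to a vector \<open>e\<close> form a reducing subspace, so minimality makes the range of \<open>\<Gamma>\<close> dense,
  and \<open>U\<close> is the unitary operator with \<open>U \<Gamma>\<^sub>1 = \<Gamma>\<^sub>2\<close>.\<close>

section \<open>Inner product spaces on carriers\<close>

text \<open>Both operator series are evaluated only between kernel functions. These are joint
  eigenvectors of the adjoints, so \<open>sigma\<close> acts on matrix elements as multiplication by
  <z,w>, and the claims reduce to the scalar identities (1/k) k = 1 and sum of a_n <z,w>^n =
  k(<z,w>). The two series then leave the kernel functions by different routes. No sign of the c_n
  is available, so the c-series needs the uniform bound extracted from its assumed strong
  convergence on \<open>H_K\<close>; the a_n are positive, so the partial sums of the a-series
  increase and are dominated by the identity. Orthogonality to every monomial is phrased without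
  multi-indices, as vanishing at 0 of all words in the adjoints. A second obstacle is that
  \<open>H_K(E)\<close> is given by its reproducing kernel, not as a tensor product: elementary
  tensors, slices and multiplication operators must first be shown to live in it. The recurring
  device is that a closed subspace containing all kernel functions is the whole space. The argument
  is run for an abstract set \<open>X\<close>, multipliers \<open>m i\<close> and a base point
  \<open>p\<close>; the ball enters only at the end.\<close>

lemma scaleC_zero_left [simp]: "0 *\<^sub>C (x::'a::complex_vector) = 0"
  using scaleC_add_left[of 0 0 x] by simp

lemma scaleC_zero_right [simp]: "c *\<^sub>C (0::'a::complex_vector) = 0"
  using scaleC_add_right[of c 0 0] by simp

lemma scaleC_minus1: "(-1) *\<^sub>C (x::'a::complex_vector) = - x"
  using scaleC_add_left[of "-1" 1 x] by (simp add: scaleC_one eq_neg_iff_add_eq_0)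

lemma scaleC_diff_right: "c *\<^sub>C (x - y) = c *\<^sub>C x - c *\<^sub>C (y::'a::complex_vector)"
  using scaleC_add_right[of c "x - y" y] by (simp add: algebra_simps)

text \<open>Since Re (i z) = - Im z, two complex-linear expressions agree once their real parts do
  for all arguments; \<open>Riesz_on_subspace\<close> and \<open>isometric_ip\<close> pass from real
  to complex identities in this way.\<close>

lemma complex_eqI_Re_ii:
  assumes "Re x = Re y" "Re (\<i> * x) = Re (\<i> * y)"
  shows "x = y"
  using assms by (simp add: complex_eq_iff)

lemma tendsto_if_bounded_by_null:
  fixes f :: "nat \<Rightarrow> 'a::real_normed_vector"
  assumes "\<And>n. norm (f n - l) \<le> g n" "g \<longlonglongrightarrow> 0"
  shows "f \<longlonglongrightarrow> l"
  by (rule LIM_zero_cancel, rule Lim_null_comparison[OF _ assms(2)]) (simp add: assms(1))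

locale inner_space =
  fixes V :: "'a::complex_vector hspace"
  assumes inner_product_space: "inner_product_space V"
begin

lemma zero_in [simp]: "0 \<in> carr V"
  and add_in [simp]: "x \<in> carr V \<Longrightarrow> y \<in> carr V \<Longrightarrow> x + y \<in> carr V"
  and scaleC_in [simp]: "x \<in> carr V \<Longrightarrow> c *\<^sub>C x \<in> carr V"
  using inner_product_space unfolding inner_product_space_def csubspace_def by auto

lemma minus_in [simp]: "x \<in> carr V \<Longrightarrow> - x \<in> carr V"
  using scaleC_in[of x "-1"] by (simp add: scaleC_minus1)

lemma diff_in [simp]: "x \<in> carr V \<Longrightarrow> y \<in> carr V \<Longrightarrow> x - y \<in> carr V"
  using add_in[of x "- y"] by simp

lemma sum_in [simp]: "(\<And>i. i \<in> A \<Longrightarrow> f i \<in> carr V) \<Longrightarrow> sum f A \<in> carr V"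
  by (induction A rule: infinite_finite_induct) auto

lemma ip_add_left: "x \<in> carr V \<Longrightarrow> y \<in> carr V \<Longrightarrow> z \<in> carr V \<Longrightarrow> ip V (x + y) z = ip V x z + ip V y z"
  and ip_scaleC_left: "x \<in> carr V \<Longrightarrow> z \<in> carr V \<Longrightarrow> ip V (c *\<^sub>C x) z = c * ip V x z"
  and ip_cnj: "x \<in> carr V \<Longrightarrow> y \<in> carr V \<Longrightarrow> ip V y x = cnj (ip V x y)"
  and ip_pos: "x \<in> carr V \<Longrightarrow> 0 \<le> Re (ip V x x)"
  and ip_definite: "x \<in> carr V \<Longrightarrow> ip V x x = 0 \<Longrightarrow> x = 0"
  using inner_product_space unfolding inner_product_space_def by meson+

lemma ip_add_right: "x \<in> carr V \<Longrightarrow> y \<in> carr V \<Longrightarrow> z \<in> carr V \<Longrightarrow> ip V z (x + y) = ip V z x + ip V z y"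
  using ip_add_left[of x y z] ip_cnj[of "x + y" z] ip_cnj[of x z] ip_cnj[of y z] by simp

lemma ip_scaleC_right: "x \<in> carr V \<Longrightarrow> z \<in> carr V \<Longrightarrow> ip V z (c *\<^sub>C x) = cnj c * ip V z x"
  using ip_scaleC_left[of x z c] ip_cnj[of "c *\<^sub>C x" z] ip_cnj[of x z] by simp

lemma ip_zero_left [simp]: "x \<in> carr V \<Longrightarrow> ip V 0 x = 0"
  using ip_scaleC_left[of 0 x 0] by simp

lemma ip_zero_right [simp]: "x \<in> carr V \<Longrightarrow> ip V x 0 = 0"
  using ip_cnj[of 0 x] by simp

lemma ip_minus_left: "x \<in> carr V \<Longrightarrow> z \<in> carr V \<Longrightarrow> ip V (- x) z = - ip V x z"
  using ip_scaleC_left[of x z "-1"] by (simp add: scaleC_minus1)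

lemma ip_minus_right: "x \<in> carr V \<Longrightarrow> z \<in> carr V \<Longrightarrow> ip V z (- x) = - ip V z x"
  using ip_scaleC_right[of x z "-1"] by (simp add: scaleC_minus1)

lemma ip_diff_left: "x \<in> carr V \<Longrightarrow> y \<in> carr V \<Longrightarrow> z \<in> carr V \<Longrightarrow> ip V (x - y) z = ip V x z - ip V y z"
  using ip_add_left[of x "- y" z] by (simp add: ip_minus_left)

lemma ip_diff_right: "x \<in> carr V \<Longrightarrow> y \<in> carr V \<Longrightarrow> z \<in> carr V \<Longrightarrow> ip V z (x - y) = ip V z x - ip V z y"
  using ip_add_right[of x "- y" z] by (simp add: ip_minus_right)

lemma ip_sum_left:
  "(\<And>i. i \<in> A \<Longrightarrow> f i \<in> carr V) \<Longrightarrow> x \<in> carr V \<Longrightarrow> ip V (sum f A) x = (\<Sum>i\<in>A. ip V (f i) x)"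
  by (induction A rule: infinite_finite_induct) (simp_all add: ip_add_left)

lemma ip_sum_right:
  "(\<And>i. i \<in> A \<Longrightarrow> f i \<in> carr V) \<Longrightarrow> x \<in> carr V \<Longrightarrow> ip V x (sum f A) = (\<Sum>i\<in>A. ip V x (f i))"
  by (induction A rule: infinite_finite_induct) (simp_all add: ip_add_right)

lemmas ip_simps = ip_add_left ip_add_right ip_scaleC_left ip_scaleC_right ip_minus_left
  ip_minus_right ip_diff_left ip_diff_right

lemma hnorm_nonneg [simp]: "x \<in> carr V \<Longrightarrow> 0 \<le> hnorm V x"
  by (simp add: hnorm_def ip_pos)

lemma hnorm_sq: "x \<in> carr V \<Longrightarrow> (hnorm V x)\<^sup>2 = Re (ip V x x)"
  by (simp add: hnorm_def ip_pos)

lemma ip_self: "x \<in> carr V \<Longrightarrow> ip V x x = complex_of_real ((hnorm V x)\<^sup>2)"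
  using ip_cnj[of x x] by (simp add: hnorm_sq complex_eq_iff)

lemma hnorm_eq_0: "x \<in> carr V \<Longrightarrow> hnorm V x = 0 \<longleftrightarrow> x = 0"
  using ip_self ip_definite ip_zero_left[of x] by fastforce

lemma hnorm_zero [simp]: "hnorm V 0 = 0"
  by (simp add: hnorm_eq_0)

lemma hnorm_scaleC: "x \<in> carr V \<Longrightarrow> hnorm V (c *\<^sub>C x) = cmod c * hnorm V x"
proof -
  assume x: "x \<in> carr V"
  have "ip V (c *\<^sub>C x) (c *\<^sub>C x) = (c * cnj c) * ip V x x"
    using x by (simp add: ip_scaleC_left ip_scaleC_right)
  also have "\<dots> = complex_of_real ((cmod c)\<^sup>2 * (hnorm V x)\<^sup>2)"
    unfolding complex_norm_square[symmetric] ip_self[OF x] by simp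
  finally have "(hnorm V (c *\<^sub>C x))\<^sup>2 = (cmod c * hnorm V x)\<^sup>2"
    unfolding hnorm_sq[OF scaleC_in[OF x]] power_mult_distrib by (simp only: Re_complex_of_real)
  then show ?thesis
    by (rule power2_eq_imp_eq) (simp_all add: x)
qed

lemma hnorm_minus: "x \<in> carr V \<Longrightarrow> hnorm V (- x) = hnorm V x"
  using hnorm_scaleC[of x "-1"] by (simp add: scaleC_minus1)

lemma hnorm_diff_commute: "x \<in> carr V \<Longrightarrow> y \<in> carr V \<Longrightarrow> hnorm V (x - y) = hnorm V (y - x)"
  using hnorm_minus[of "x - y"] by simp

sublocale Metric_space "carr V" "hdist V"
  by (rule Metric_space_hdist[OF inner_product_space])

lemma hnorm_triangle: "x \<in> carr V \<Longrightarrow> y \<in> carr V \<Longrightarrow> hnorm V (x + y) \<le> hnorm V x + hnorm V y"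
  using triangle[of x 0 "- y"] by (simp add: hdist_def)

lemma hnorm_triangle_diff: "x \<in> carr V \<Longrightarrow> y \<in> carr V \<Longrightarrow> hnorm V (x - y) \<le> hnorm V x + hnorm V y"
  using hnorm_triangle[of x "- y"] by (simp add: hnorm_minus)

lemma hnorm_triangle_ineq3:
  "x \<in> carr V \<Longrightarrow> y \<in> carr V \<Longrightarrow> \<bar>hnorm V x - hnorm V y\<bar> \<le> hnorm V (x - y)"
  using hnorm_triangle[of "x - y" y] hnorm_triangle[of "y - x" x] hnorm_diff_commute[of x y] by simp

lemma parallelogram:
  assumes "x \<in> carr V" "y \<in> carr V"
  shows "(hnorm V (x + y))\<^sup>2 + (hnorm V (x - y))\<^sup>2 = 2 * (hnorm V x)\<^sup>2 + 2 * (hnorm V y)\<^sup>2"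
  using assms by (simp add: hnorm_sq ip_simps)

lemma Cauchy_Schwarz:
  assumes x: "x \<in> carr V" and y: "y \<in> carr V"
  shows "cmod (ip V x y) \<le> hnorm V x * hnorm V y"
proof (cases "y = 0")
  case False
  then have n: "0 < hnorm V y"
    using y hnorm_eq_0 hnorm_nonneg by (simp add: order_less_le)
  define p where "p = ip V x y"
  define b where "b = complex_of_real ((hnorm V y)\<^sup>2)"
  \<comment> \<open>\<open>u\<close> is the component of \<open>x\<close> orthogonal to
    \<open>y\<close>, multiplied by the squared norm of \<open>y\<close> to avoid a
    division.\<close>
  define u where "u = b *\<^sub>C x - p *\<^sub>C y"
  have u: "u \<in> carr V"
    using x y by (simp add: u_def)
  have yx: "ip V y x = cnj p" and xy: "ip V x y = p" and yy: "ip V y y = b"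
    using ip_cnj[OF x y] ip_self[OF y] by (simp_all add: p_def b_def)
  have "ip V u u = b * (b * ip V x x - p * cnj p)"
    using x y unfolding u_def
    by (simp add: ip_diff_left ip_diff_right ip_scaleC_left ip_scaleC_right yx xy yy)
      (simp add: b_def algebra_simps)
  also have "\<dots> = complex_of_real ((hnorm V y)\<^sup>2 * ((hnorm V y)\<^sup>2 * (hnorm V x)\<^sup>2 - (cmod p)\<^sup>2))"
    unfolding complex_norm_square[symmetric] b_def ip_self[OF x] by simp
  finally have "0 \<le> (hnorm V y)\<^sup>2 * ((hnorm V y)\<^sup>2 * (hnorm V x)\<^sup>2 - (cmod p)\<^sup>2)"
    using ip_pos[OF u] by (simp only: Re_complex_of_real)
  then have "(cmod p)\<^sup>2 \<le> (hnorm V x * hnorm V y)\<^sup>2"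
    using n by (simp add: zero_le_mult_iff power_mult_distrib mult.commute)
  then show ?thesis
    unfolding p_def by (rule power2_le_imp_le) (simp add: x y)
qed (simp add: x)

lemma eqI_ip:
  assumes "x \<in> carr V" "y \<in> carr V" "\<And>u. u \<in> carr V \<Longrightarrow> ip V u x = ip V u y"
  shows "x = y"
  using assms ip_definite[of "x - y"] by (simp add: ip_diff_right)

lemma eqI_ip_left:
  assumes "x \<in> carr V" "y \<in> carr V" "\<And>u. u \<in> carr V \<Longrightarrow> ip V x u = ip V y u"
  shows "x = y"
  using assms ip_definite[of "x - y"] by (simp add: ip_diff_left)

text \<open>Test with \<open>u = x\<close> and cancel one factor; \<open>0 \<le> C\<close> handles
  \<open>x = 0\<close>. Norm bounds for adjoints and for point evaluation are obtained from bounds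
  on forms in this way.\<close>

lemma hnorm_le_ip:
  assumes "x \<in> carr V" "0 \<le> C" "\<And>u. u \<in> carr V \<Longrightarrow> cmod (ip V u x) \<le> C * hnorm V u"
  shows "hnorm V x \<le> C"
proof -
  have "hnorm V x * hnorm V x \<le> C * hnorm V x"
    using assms(1) assms(3)[OF assms(1)] unfolding ip_self[OF assms(1)]
    by (simp add: norm_mult power2_eq_square)
  then show ?thesis
    using assms(1,2) hnorm_nonneg[OF assms(1)] by (cases "hnorm V x = 0") auto
qed

text \<open>Stated as a real null sequence, so that the limit rules for reals apply;
  \<open>conv_iff_limitin\<close> connects it with the metric topology used in the definitions of
  the problem.\<close>

definition conv :: "(nat \<Rightarrow> 'a) \<Rightarrow> 'a \<Rightarrow> bool" where
  "conv s x \<longleftrightarrow> (\<forall>n. s n \<in> carr V) \<and> x \<in> carr V \<and> (\<lambda>n. hnorm V (s n - x)) \<longlonglongrightarrow> 0"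

lemma convD: "conv s x \<Longrightarrow> s n \<in> carr V" "conv s x \<Longrightarrow> x \<in> carr V"
  "conv s x \<Longrightarrow> (\<lambda>n. hnorm V (s n - x)) \<longlonglongrightarrow> 0"
  by (auto simp: conv_def)

lemma convI:
  assumes "\<And>n. s n \<in> carr V" "x \<in> carr V" "\<And>n. hnorm V (s n - x) \<le> g n" "g \<longlonglongrightarrow> 0"
  shows "conv s x"
  unfolding conv_def
proof (intro conjI allI assms(1,2))
  show "(\<lambda>n. hnorm V (s n - x)) \<longlonglongrightarrow> 0"
    by (rule tendsto_if_bounded_by_null[OF _ assms(4)]) (simp add: assms(1-3))
qed

lemma conv_iff_limitin:
  assumes "\<And>n. s n \<in> carr V"
  shows "conv s x \<longleftrightarrow> limitin mtopology s x sequentially"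
  using assms
  by (auto simp: conv_def limitin_metric tendsto_iff hdist_def)

lemma conv_ip_left:
  assumes "conv s x" "y \<in> carr V"
  shows "(\<lambda>n. ip V (s n) y) \<longlonglongrightarrow> ip V x y"
proof (rule tendsto_if_bounded_by_null)
  show "(\<lambda>n. hnorm V (s n - x) * hnorm V y) \<longlonglongrightarrow> 0"
    by (rule tendsto_mult_left_zero[OF convD(3)[OF assms(1)]])
  show "cmod (ip V (s n) y - ip V x y) \<le> hnorm V (s n - x) * hnorm V y" for n
    unfolding ip_diff_left[OF convD(1)[OF assms(1)] convD(2)[OF assms(1)] assms(2), symmetric]
    by (intro Cauchy_Schwarz diff_in convD[OF assms(1)] assms(2))
qed

lemma conv_ip_right: "conv s x \<Longrightarrow> y \<in> carr V \<Longrightarrow> (\<lambda>n. ip V y (s n)) \<longlonglongrightarrow> ip V y x"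
  using tendsto_cnj[OF conv_ip_left[of s x y]] ip_cnj[of _ y] convD[of s x] by simp

lemma conv_hnorm:
  assumes "conv s x"
  shows "(\<lambda>n. hnorm V (s n)) \<longlonglongrightarrow> hnorm V x"
proof (rule tendsto_if_bounded_by_null[OF _ convD(3)[OF assms]])
  show "norm (hnorm V (s n) - hnorm V x) \<le> hnorm V (s n - x)" for n
    using hnorm_triangle_ineq3 convD[OF assms] by simp
qed

lemma conv_const: "x \<in> carr V \<Longrightarrow> conv (\<lambda>_. x) x"
  by (simp add: conv_def)

lemma conv_add:
  assumes "conv s x" "conv t y"
  shows "conv (\<lambda>n. s n + t n) (x + y)"
proof -
  note c = convD[OF assms(1)] convD[OF assms(2)]
  show ?thesis
  proof (rule convI)
    show "(\<lambda>n. hnorm V (s n - x) + hnorm V (t n - y)) \<longlonglongrightarrow> 0"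
      using tendsto_add[OF c(3,6)] by simp
    fix n
    have "s n + t n - (x + y) = (s n - x) + (t n - y)"
      by simp
    moreover have "hnorm V ((s n - x) + (t n - y)) \<le> hnorm V (s n - x) + hnorm V (t n - y)"
      by (intro hnorm_triangle diff_in c(1,2,4,5))
    ultimately show "hnorm V (s n + t n - (x + y)) \<le> hnorm V (s n - x) + hnorm V (t n - y)"
      by (simp only:)
  qed (intro add_in c(1,2,4,5))+
qed

lemma conv_scaleC:
  assumes "conv s x"
  shows "conv (\<lambda>n. c *\<^sub>C s n) (c *\<^sub>C x)"
  unfolding conv_def scaleC_diff_right[symmetric]
proof (intro conjI allI)
  show "(\<lambda>n. hnorm V (c *\<^sub>C (s n - x))) \<longlonglongrightarrow> 0"
    unfolding hnorm_scaleC[OF diff_in[OF convD(1)[OF assms] convD(2)[OF assms]]]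
    by (rule tendsto_mult_right_zero[OF convD(3)[OF assms]])
qed (intro scaleC_in convD[OF assms])+

lemma hnorm_add_sq: "x \<in> carr V \<Longrightarrow> y \<in> carr V \<Longrightarrow>
  (hnorm V (x + y))\<^sup>2 = (hnorm V x)\<^sup>2 + 2 * Re (ip V x y) + (hnorm V y)\<^sup>2"
  using ip_cnj[of x y] by (simp add: hnorm_sq ip_simps)

lemma closed_subspaceI:
  assumes "csubspace M" "M \<subseteq> carr V" "\<And>s x. (\<And>n. s n \<in> M) \<Longrightarrow> conv s x \<Longrightarrow> x \<in> M"
  shows "closed_subspace V M"
  unfolding closed_subspace_def metric_closedin_iff_sequentially_closed
proof (intro conjI allI impI assms(1,2))
  fix s x assume "range s \<subseteq> M \<and> limitin mtopology s x sequentially"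
  then show "x \<in> M"
    using assms(2) by (intro assms(3)[of s x] conv_iff_limitin[THEN iffD2]) auto
qed

end

section \<open>Hilbert spaces and the Riesz representation\<close>

locale hilb = inner_space +
  assumes mcomplete: "mcomplete"
begin

lemma conv_if_Cauchy:
  assumes s: "\<And>n. s n \<in> carr V"
    and C: "\<And>\<epsilon>. 0 < \<epsilon> \<Longrightarrow> \<exists>N. \<forall>n\<ge>N. \<forall>m\<ge>N. hnorm V (s n - s m) < \<epsilon>"
  obtains x where "conv s x"
proof -
  have "MCauchy s"
    unfolding MCauchy_def hdist_def using s C by auto
  then show ?thesis
    using mcomplete that conv_iff_limitin[of s, OF s] unfolding mcomplete_def by blast
qed

text \<open>The representing vector is the limit of a minimising sequence of
  \<open>\<parallel>u\<parallel>\<^sup>2 - 2 Re (\<phi> u)\<close>. Since \<open>D\<close> need not be closed, this also yields density criteria.\<close>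

lemma Riesz_on_subspace:
  assumes D: "csubspace D" "D \<subseteq> carr V"
    and add: "\<And>u v. u \<in> D \<Longrightarrow> v \<in> D \<Longrightarrow> \<phi> (u + v) = \<phi> u + \<phi> v"
    and scl: "\<And>t u. u \<in> D \<Longrightarrow> \<phi> (t *\<^sub>C u) = t * \<phi> u"
    and bdd: "\<And>u. u \<in> D \<Longrightarrow> cmod (\<phi> u) \<le> C * hnorm V u"
  obtains x s where "x \<in> carr V" "\<And>u. u \<in> D \<Longrightarrow> ip V u x = \<phi> u" "\<And>n. s n \<in> D" "conv s x"
proof -
  have D0: "0 \<in> D" and Dadd: "\<And>u v. u \<in> D \<Longrightarrow> v \<in> D \<Longrightarrow> u + v \<in> D"
    and Dscl: "\<And>t u. u \<in> D \<Longrightarrow> t *\<^sub>C u \<in> D" and DV: "\<And>u. u \<in> D \<Longrightarrow> u \<in> carr V"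
    using D by (auto simp: csubspace_def)
  define J where "J u = (hnorm V u)\<^sup>2 - 2 * Re (\<phi> u)" for u
  have J_lower: "- C\<^sup>2 \<le> J u" if "u \<in> D" for u
  proof -
    have "Re (\<phi> u) \<le> C * hnorm V u"
      using bdd[OF that] complex_Re_le_cmod[of "\<phi> u"] by linarith
    moreover have "0 \<le> (hnorm V u - C)\<^sup>2"
      by simp
    ultimately show ?thesis
      by (simp add: J_def power2_diff mult.commute)
  qed
  define m where "m = Inf (J ` D)"
  have bb: "bdd_below (J ` D)"
    using bdd_belowI2[OF J_lower] .
  have m_le: "m \<le> J u" if "u \<in> D" for u
    unfolding m_def using bb that by (rule cINF_lower)
  have "\<exists>u\<in>D. J u < m + 1 / real (Suc n)" for n
    using cInf_lessD[of "J ` D" "m + 1 / real (Suc n)"] D0 by (force simp: m_def)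
  then obtain s where s: "\<And>n. s n \<in> D" "\<And>n. J (s n) < m + 1 / real (Suc n)"
    by metis
  have sV: "s n \<in> carr V" for n
    using DV s(1) .
  \<comment> \<open>Parallelogram law: the midpoint \<open>h\<close> lies in \<open>D\<close>, so
    \<open>m \<le> J h\<close>, and two almost minimal vectors must be close to each other.\<close>
  have close: "(hnorm V (s n - s p))\<^sup>2 \<le> 2 / real (Suc n) + 2 / real (Suc p)" for n p
  proof -
    define h where "h = (1/2::complex) *\<^sub>C (s n + s p)"
    have h: "h \<in> D"
      using Dscl Dadd s(1) by (simp add: h_def)
    have "4 * (hnorm V h)\<^sup>2 = (hnorm V (s n + s p))\<^sup>2"
      using sV by (simp add: h_def hnorm_scaleC norm_divide power_divide)
    moreover have "2 * Re (\<phi> h) = Re (\<phi> (s n)) + Re (\<phi> (s p))"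
      using s(1) by (simp add: h_def scl add Dadd)
    ultimately have "(hnorm V (s n - s p))\<^sup>2 = 2 * J (s n) + 2 * J (s p) - 4 * J h"
      using parallelogram[OF sV sV, of n p] by (simp add: J_def)
    then show ?thesis
      using s(2)[of n] s(2)[of p] m_le[OF h] by simp
  qed
  obtain x where x: "conv s x"
  proof (rule conv_if_Cauchy[OF sV])
    fix \<epsilon> :: real assume \<epsilon>: "0 < \<epsilon>"
    then obtain N where N: "1 / real (Suc N) < \<epsilon>\<^sup>2 / 4"
      using reals_Archimedean[of "\<epsilon>\<^sup>2 / 4"] by (auto simp: inverse_eq_divide)
    have "hnorm V (s n - s p) < \<epsilon>" if "N \<le> n" "N \<le> p" for n p
    proof -
      have le: "1 / real (Suc q) \<le> 1 / real (Suc N)" if "N \<le> q" for q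
        using that by (simp add: frac_le)
      have "(hnorm V (s n - s p))\<^sup>2 < \<epsilon>\<^sup>2"
        using close[of n p] N le[OF that(1)] le[OF that(2)] by simp
      then show ?thesis
        using \<epsilon> by (meson less_imp_le power_less_imp_less_base)
    qed
    then show "\<exists>N. \<forall>n\<ge>N. \<forall>p\<ge>N. hnorm V (s n - s p) < \<epsilon>"
      by blast
  qed
  have xV: "x \<in> carr V"
    using convD(2)[OF x] .
  have Re_eq: "Re (ip V v x) = Re (\<phi> v)" if v: "v \<in> D" for v
  proof -
    define b where "b = Re (ip V x v) - Re (\<phi> v)"
    have "0 \<le> t\<^sup>2 * (hnorm V v)\<^sup>2 + 2 * t * b" for t :: real
    proof (rule LIMSEQ_le_const)
      show "(\<lambda>n. t\<^sup>2 * (hnorm V v)\<^sup>2 + 2 * t * (Re (ip V (s n) v) - Re (\<phi> v)) + 1 / real (Suc n))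
        \<longlonglongrightarrow> t\<^sup>2 * (hnorm V v)\<^sup>2 + 2 * t * b"
        unfolding b_def
        using tendsto_add[OF tendsto_add[OF tendsto_const tendsto_mult[OF tendsto_const
              tendsto_diff[OF tendsto_Re[OF conv_ip_left[OF x DV[OF v]]] tendsto_const]]]
            LIMSEQ_inverse_real_of_nat]
        by (simp add: inverse_eq_divide)
      have "0 \<le> t\<^sup>2 * (hnorm V v)\<^sup>2 + 2 * t * (Re (ip V (s n) v) - Re (\<phi> v)) + 1 / real (Suc n)" for n
      proof -
        have w: "of_real t *\<^sub>C v \<in> D"
          using v Dscl by simp
        have "J (s n + of_real t *\<^sub>C v) = J (s n) + t\<^sup>2 * (hnorm V v)\<^sup>2 + 2 * t * (Re (ip V (s n) v) - Re (\<phi> v))"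
          using w hnorm_add_sq[OF sV DV[OF w], of n] s(1)[of n] v sV[of n] DV[OF v]
          by (simp add: J_def add scl hnorm_scaleC ip_scaleC_right power_mult_distrib algebra_simps)
        then show ?thesis
          using m_le[OF Dadd[OF s(1)[of n] w]] s(2)[of n] by simp
      qed
      then show "\<exists>N. \<forall>n\<ge>N. 0 \<le> t\<^sup>2 * (hnorm V v)\<^sup>2 + 2 * t * (Re (ip V (s n) v) - Re (\<phi> v)) + 1 / real (Suc n)"
        by blast
    qed
    note q = this
    have "b = 0"
    proof (rule ccontr)
      assume "b \<noteq> 0"
      \<comment> \<open>The summand 1 keeps the denominator positive when \<open>v = 0\<close>. At t
        = - b / h the quadratic is at most - b^2 / h, contradicting its nonnegativity.\<close>
      define h where "h = (hnorm V v)\<^sup>2 + 1"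
      have h: "0 < h"
        unfolding h_def by (simp add: add_nonneg_pos)
      have "(- b / h)\<^sup>2 * (hnorm V v)\<^sup>2 + 2 * (- b / h) * b \<le> (- b / h)\<^sup>2 * h + 2 * (- b / h) * b"
        by (simp add: h_def mult_left_mono)
      also have "\<dots> = - (b\<^sup>2 / h)"
        using h by (simp add: field_simps power2_eq_square)
      also have "\<dots> < 0"
        using h \<open>b \<noteq> 0\<close> by simp
      finally show False
        using q[of "- b / h"] by linarith
    qed
    then show ?thesis
      using ip_cnj[OF xV DV[OF v]] by (simp add: b_def)
  qed
  have "ip V v x = \<phi> v" if v: "v \<in> D" for v
  proof (rule complex_eqI_Re_ii)
    show "Re (\<i> * ip V v x) = Re (\<i> * \<phi> v)"
      using Re_eq[OF Dscl[OF v], of \<i>] by (simp only: scl[OF v] ip_scaleC_left[OF DV[OF v] xV])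
  qed (rule Re_eq[OF v])
  then show ?thesis
    using that xV s(1) x by blast
qed

lemma csubspace_carr: "csubspace (carr V)"
  by (simp add: csubspace_def)

lemma Riesz:
  assumes "\<And>u v. u \<in> carr V \<Longrightarrow> v \<in> carr V \<Longrightarrow> \<phi> (u + v) = \<phi> u + \<phi> v"
    and "\<And>t u. u \<in> carr V \<Longrightarrow> \<phi> (t *\<^sub>C u) = t * \<phi> u"
    and "\<And>u. u \<in> carr V \<Longrightarrow> cmod (\<phi> u) \<le> C * hnorm V u"
  obtains x where "x \<in> carr V" "\<And>u. u \<in> carr V \<Longrightarrow> ip V u x = \<phi> u"
  using Riesz_on_subspace[OF csubspace_carr order_refl assms] by metis

text \<open>The functional \<open>\<lambda>u. ip V u x\<close> restricted to \<open>D\<close> is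
  represented by a limit \<open>y\<close> of vectors of \<open>D\<close>. As \<open>x - y\<close> is
  orthogonal to \<open>D\<close>, it vanishes, and the sequence for \<open>y\<close> serves for
  \<open>x\<close>.\<close>

lemma dense_if_ortho_trivial:
  assumes D: "csubspace D" "D \<subseteq> carr V"
    and ortho: "\<And>x. x \<in> carr V \<Longrightarrow> (\<And>u. u \<in> D \<Longrightarrow> ip V u x = 0) \<Longrightarrow> x = 0"
    and x: "x \<in> carr V"
  obtains s where "\<And>n. s n \<in> D" "conv s x"
proof -
  have D': "u \<in> carr V" if "u \<in> D" for u
    using that D by blast
  have bdd: "cmod (ip V u x) \<le> hnorm V x * hnorm V u" if "u \<in> D" for u
    using Cauchy_Schwarz[OF D'[OF that] x] by (simp add: mult.commute)
  obtain y s where y: "y \<in> carr V" "\<And>u. u \<in> D \<Longrightarrow> ip V u y = ip V u x" "\<And>n. s n \<in> D" "conv s y"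
    by (rule Riesz_on_subspace[OF D, of "\<lambda>u. ip V u x" "hnorm V x"])
      (simp_all add: ip_add_left ip_scaleC_left D' x bdd, blast)
  have "x - y = 0"
    using x y D' by (intro ortho) (simp_all add: ip_diff_right)
  then show ?thesis
    using that[of s] y by simp
qed

text \<open>Used as an induction principle: a property that is linear and stable under limits holds
  everywhere once it holds on a total set, which below consists of kernel functions.\<close>

lemma closed_subspace_eq_carr:
  assumes N: "csubspace N" "N \<subseteq> carr V"
    and closed: "\<And>s x. (\<And>n. s n \<in> N) \<Longrightarrow> conv s x \<Longrightarrow> x \<in> N"
    and ortho: "\<And>x. x \<in> carr V \<Longrightarrow> (\<And>u. u \<in> N \<Longrightarrow> ip V u x = 0) \<Longrightarrow> x = 0"
  shows "N = carr V"
  using N(2) dense_if_ortho_trivial[OF N ortho] closed by (metis subsetI subset_antisym)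

end

lemma hilbI: "hilbert_space V \<Longrightarrow> hilb V"
  by (simp add: hilbert_space_def hilb_def hilb_axioms_def inner_space_def)

section \<open>Bounded operators\<close>

lemma bounded_op_in: "bounded_op V W A \<Longrightarrow> x \<in> carr V \<Longrightarrow> A x \<in> carr W"
  and bounded_op_add: "bounded_op V W A \<Longrightarrow> x \<in> carr V \<Longrightarrow> y \<in> carr V \<Longrightarrow> A (x + y) = A x + A y"
  and bounded_op_scaleC: "bounded_op V W A \<Longrightarrow> x \<in> carr V \<Longrightarrow> A (t *\<^sub>C x) = t *\<^sub>C A x"
  by (auto simp: bounded_op_def linear_op_def)

lemma linear_op_zero:
  assumes "linear_op V W A" "inner_space V"
  shows "A 0 = 0"
  using assms inner_space.zero_in[OF assms(2)] unfolding linear_op_def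
  by (metis scaleC_zero_left)

lemma linear_op_diff:
  assumes "linear_op V W A" "inner_space V" "x \<in> carr V" "y \<in> carr V"
  shows "A (x - y) = A x - A y"
proof -
  interpret inner_space V by fact
  have "A (x - y + y) = A (x - y) + A y"
    using assms unfolding linear_op_def by (metis diff_in)
  then show ?thesis by simp
qed

lemma linear_op_sum:
  assumes "linear_op V W A" "inner_space V" "\<And>i. i \<in> I \<Longrightarrow> f i \<in> carr V"
  shows "A (sum f I) = (\<Sum>i\<in>I. A (f i))"
  using assms(3)
proof (induction I rule: infinite_finite_induct)
  case (insert i I)
  have "f i \<in> carr V" "sum f I \<in> carr V"
    using insert.prems by (auto intro: inner_space.sum_in[OF assms(2)])
  then have "A (f i + sum f I) = A (f i) + A (sum f I)"
    using assms(1) by (simp add: linear_op_def)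
  then show ?case
    using insert by simp
qed (simp_all add: linear_op_zero[OF assms(1,2)])

lemma bounded_op_bound:
  assumes "bounded_op V W A" "inner_space V"
  obtains B where "0 \<le> B" "\<And>x. x \<in> carr V \<Longrightarrow> hnorm W (A x) \<le> B * hnorm V x"
proof -
  interpret inner_space V by fact
  obtain B where B: "\<And>x. x \<in> carr V \<Longrightarrow> hnorm W (A x) \<le> B * hnorm V x"
    using assms unfolding bounded_op_def by blast
  show ?thesis
  proof (rule that[of "\<bar>B\<bar>"])
    show "hnorm W (A x) \<le> \<bar>B\<bar> * hnorm V x" if "x \<in> carr V" for x
      using B[OF that] mult_right_mono[OF abs_ge_self hnorm_nonneg[OF that], of B] by linarith
  qed simp
qed

lemma bounded_op_diff:
  "bounded_op V W A \<Longrightarrow> inner_space V \<Longrightarrow> x \<in> carr V \<Longrightarrow> y \<in> carr V \<Longrightarrow> A (x - y) = A x - A y"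
  by (auto simp: bounded_op_def intro: linear_op_diff)

lemma bounded_op_sum:
  "bounded_op V W A \<Longrightarrow> inner_space V \<Longrightarrow> (\<And>i. i \<in> I \<Longrightarrow> f i \<in> carr V) \<Longrightarrow> A (sum f I) = (\<Sum>i\<in>I. A (f i))"
  by (auto simp: bounded_op_def intro: linear_op_sum)

lemma bounded_op_conv:
  assumes A: "bounded_op V W A" and V: "inner_space V" and W: "inner_space W"
    and s: "inner_space.conv V s x"
  shows "inner_space.conv W (\<lambda>n. A (s n)) (A x)"
proof -
  interpret V: inner_space V by fact
  interpret W: inner_space W by fact
  note c = V.convD[OF s]
  obtain B where B: "\<And>x. x \<in> carr V \<Longrightarrow> hnorm W (A x) \<le> B * hnorm V x"
    using bounded_op_bound[OF A V] by metis
  show ?thesis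
  proof (rule W.convI)
    show "(\<lambda>n. B * hnorm V (s n - x)) \<longlonglongrightarrow> 0"
      by (rule tendsto_mult_right_zero[OF c(3)])
    show "hnorm W (A (s n) - A x) \<le> B * hnorm V (s n - x)" for n
      using B[OF V.diff_in[OF c(1)[of n] c(2)]] bounded_op_diff[OF A V c(1)[of n] c(2)] by simp
  qed (intro bounded_op_in[OF A] c(1,2))+
qed

lemma bounded_op_id: "bounded_op V V (\<lambda>x. x)"
  unfolding bounded_op_def linear_op_def by (auto intro!: exI[of _ 1])

lemma bounded_op_compose:
  assumes A: "bounded_op V W A" and C: "bounded_op W X C" and V: "inner_space V" and W: "inner_space W"
  shows "bounded_op V X (\<lambda>x. C (A x))"
proof -
  obtain a where a: "\<And>x. x \<in> carr V \<Longrightarrow> hnorm W (A x) \<le> a * hnorm V x"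
    using bounded_op_bound[OF A V] by metis
  obtain c where c: "0 \<le> c" "\<And>x. x \<in> carr W \<Longrightarrow> hnorm X (C x) \<le> c * hnorm W x"
    using bounded_op_bound[OF C W] by metis
  have "hnorm X (C (A x)) \<le> (c * a) * hnorm V x" if "x \<in> carr V" for x
    using order_trans[OF c(2)[OF bounded_op_in[OF A that]] mult_left_mono[OF a[OF that] c(1)]]
    by (simp add: mult.assoc)
  then show ?thesis
    using A C unfolding bounded_op_def linear_op_def by auto
qed

lemma bounded_op_plus:
  assumes A: "bounded_op V W A" and C: "bounded_op V W C" and V: "inner_space V" and W: "inner_space W"
  shows "bounded_op V W (\<lambda>x. A x + C x)"
proof -
  interpret W: inner_space W by fact
  obtain a where a: "\<And>x. x \<in> carr V \<Longrightarrow> hnorm W (A x) \<le> a * hnorm V x"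
    using bounded_op_bound[OF A V] by metis
  obtain c where c: "\<And>x. x \<in> carr V \<Longrightarrow> hnorm W (C x) \<le> c * hnorm V x"
    using bounded_op_bound[OF C V] by metis
  have "hnorm W (A x + C x) \<le> (a + c) * hnorm V x" if "x \<in> carr V" for x
    using W.hnorm_triangle[OF bounded_op_in[OF A that] bounded_op_in[OF C that]] a[OF that] c[OF that]
    by (simp add: distrib_right)
  then show ?thesis
    using A C unfolding bounded_op_def linear_op_def by (auto simp: scaleC_add_right)
qed

lemma bounded_op_scale:
  assumes A: "bounded_op V W A" and V: "inner_space V" and W: "inner_space W"
  shows "bounded_op V W (\<lambda>x. t *\<^sub>C A x)"
proof -
  interpret W: inner_space W by fact
  obtain a where a: "\<And>x. x \<in> carr V \<Longrightarrow> hnorm W (A x) \<le> a * hnorm V x"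
    using bounded_op_bound[OF A V] by metis
  have "hnorm W (t *\<^sub>C A x) \<le> (cmod t * a) * hnorm V x" if "x \<in> carr V" for x
    using mult_left_mono[OF a[OF that] norm_ge_zero[of t]] W.hnorm_scaleC[OF bounded_op_in[OF A that]]
    by (simp add: mult.assoc)
  then show ?thesis
    using A W.scaleC_in unfolding bounded_op_def linear_op_def
    by (intro conjI exI[of _ "cmod t * a"]) (auto simp: scaleC_add_right scaleC_scaleC mult.commute)
qed

lemma bounded_op_sum_fun:
  assumes "\<And>i. i \<in> I \<Longrightarrow> bounded_op V W (A i)" and V: "inner_space V" and W: "inner_space W"
  shows "bounded_op V W (\<lambda>x. \<Sum>i\<in>I. A i x)"
  using assms(1)
proof (induction I rule: infinite_finite_induct)
  case (insert i I)
  then show ?case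
    using bounded_op_plus[OF _ _ V W] by simp
next
  case (infinite I)
  then show ?case
    using inner_space.zero_in[OF W] inner_space.hnorm_zero[OF W]
    by (auto simp: bounded_op_def linear_op_def intro: exI[of _ 0])
next
  case empty
  then show ?case
    using inner_space.zero_in[OF W] inner_space.hnorm_zero[OF W]
    by (auto simp: bounded_op_def linear_op_def intro: exI[of _ 0])
qed

section \<open>Adjoints, uniform boundedness, convergence from dense sets\<close>

context hilb
begin

text \<open>Riesz gives existence and \<open>eqI_ip\<close> uniqueness for the definite description
  that defines \<open>adj\<close>.\<close>

lemma adj_char:
  assumes A: "bounded_op V W A" and W: "inner_space W" and y: "y \<in> carr W"
  shows "adj V W A y \<in> carr V \<and> (\<forall>u\<in>carr V. ip W (A u) y = ip V u (adj V W A y))"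
  unfolding adj_def
proof (rule theI')
  interpret W: inner_space W by fact
  have VV: "inner_space V"
    by (rule inner_space_axioms)
  obtain B where B: "\<And>x. x \<in> carr V \<Longrightarrow> hnorm W (A x) \<le> B * hnorm V x"
    using bounded_op_bound[OF A VV] by metis
  have bd: "cmod (ip W (A u) y) \<le> (B * hnorm W y) * hnorm V u" if "u \<in> carr V" for u
    using order_trans[OF W.Cauchy_Schwarz[OF bounded_op_in[OF A that] y]
      mult_right_mono[OF B[OF that] W.hnorm_nonneg[OF y]]] by (simp add: mult_ac)
  obtain x where "x \<in> carr V" "\<And>u. u \<in> carr V \<Longrightarrow> ip V u x = ip W (A u) y"
    by (rule Riesz[of "\<lambda>u. ip W (A u) y" "B * hnorm W y"])
      (simp_all add: bounded_op_add[OF A] bounded_op_scaleC[OF A] bounded_op_in[OF A]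
        W.ip_add_left W.ip_scaleC_left y bd)
  then show "\<exists>!x. x \<in> carr V \<and> (\<forall>u\<in>carr V. ip W (A u) y = ip V u x)"
    by (intro ex1I[of _ x]) (auto intro: eqI_ip)
qed

lemma adj_in: "bounded_op V W A \<Longrightarrow> inner_space W \<Longrightarrow> y \<in> carr W \<Longrightarrow> adj V W A y \<in> carr V"
  and ip_adj: "bounded_op V W A \<Longrightarrow> inner_space W \<Longrightarrow> y \<in> carr W \<Longrightarrow> u \<in> carr V \<Longrightarrow>
    ip V u (adj V W A y) = ip W (A u) y"
  using adj_char by metis+

lemma ip_adj_left:
  assumes "bounded_op V W A" "inner_space W" "y \<in> carr W" "u \<in> carr V"
  shows "ip V (adj V W A y) u = ip W y (A u)"
  using ip_adj[OF assms] ip_cnj[OF assms(4) adj_in[OF assms(1-3)]]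
    inner_space.ip_cnj[OF assms(2) bounded_op_in[OF assms(1,4)] assms(3)] by simp

lemma bounded_op_adj:
  assumes A: "bounded_op V W A" and W: "inner_space W"
  shows "bounded_op W V (adj V W A)"
  unfolding bounded_op_def linear_op_def
proof (intro conjI ballI allI)
  interpret W: inner_space W by fact
  note A_in = bounded_op_in[OF A] and a_in = adj_in[OF A W] and ip_a = ip_adj[OF A W]
  show "adj V W A y \<in> carr V" if "y \<in> carr W" for y
    by (rule a_in[OF that])
  show "adj V W A (x + y) = adj V W A x + adj V W A y" if "x \<in> carr W" "y \<in> carr W" for x y
    by (rule eqI_ip) (simp_all add: that A_in a_in ip_a ip_add_right W.ip_add_right)
  show "adj V W A (t *\<^sub>C x) = t *\<^sub>C adj V W A x" if "x \<in> carr W" for t x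
    by (rule eqI_ip) (simp_all add: that A_in a_in ip_a ip_scaleC_right W.ip_scaleC_right)
  obtain B where B: "0 \<le> B" "\<And>x. x \<in> carr V \<Longrightarrow> hnorm W (A x) \<le> B * hnorm V x"
    using bounded_op_bound[OF A inner_space_axioms] by metis
  have "hnorm V (adj V W A y) \<le> B * hnorm W y" if y: "y \<in> carr W" for y
  proof (rule hnorm_le_ip)
    show "0 \<le> B * hnorm W y"
      by (intro mult_nonneg_nonneg B(1) W.hnorm_nonneg y)
    show "cmod (ip V u (adj V W A y)) \<le> B * hnorm W y * hnorm V u" if "u \<in> carr V" for u
      using order_trans[OF W.Cauchy_Schwarz[OF A_in[OF that] y]
        mult_right_mono[OF B(2)[OF that] W.hnorm_nonneg[OF y]]]
      by (simp add: ip_a[OF y that] mult_ac)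
  qed (rule a_in[OF y])
  then show "\<exists>B. \<forall>y\<in>carr W. hnorm V (adj V W A y) \<le> B * hnorm W y"
    by blast
qed

lemma uniform_boundedness:
  fixes S :: "nat \<Rightarrow> 'a \<Rightarrow> 'a"
  assumes S: "\<And>n. bounded_op V V (S n)"
    and pw: "\<And>x. x \<in> carr V \<Longrightarrow> \<exists>M. \<forall>n. hnorm V (S n x) \<le> M"
  obtains B where "0 \<le> B" "\<And>n x. x \<in> carr V \<Longrightarrow> hnorm V (S n x) \<le> B * hnorm V x"
proof -
  have VV: "inner_space V"
    by (rule inner_space_axioms)
  define A where "A k = {x \<in> carr V. \<forall>n. hnorm V (S n x) \<le> real k}" for k :: nat
  have closed: "closedin mtopology (A k)" for k
    unfolding metric_closedin_iff_sequentially_closed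
  proof (intro conjI allI impI)
    show "A k \<subseteq> carr V"
      by (auto simp: A_def)
    fix s x assume sx: "range s \<subseteq> A k \<and> limitin mtopology s x sequentially"
    then have c: "conv s x"
      by (subst conv_iff_limitin) (auto simp: A_def)
    have "hnorm V (S n x) \<le> real k" for n
      using sx by (intro LIMSEQ_le_const2[OF conv_hnorm[OF bounded_op_conv[OF S VV VV c]]])
        (auto simp: A_def)
    then show "x \<in> A k"
      using convD(2)[OF c] by (simp add: A_def)
  qed
  have "\<Union>(range A) = carr V"
  proof -
    have "x \<in> \<Union>(range A)" if x: "x \<in> carr V" for x
    proof -
      obtain M where M: "\<And>n. hnorm V (S n x) \<le> M"
        using pw[OF x] by blast
      obtain k where "M \<le> real k"
        using real_arch_simple by blast
      then have "x \<in> A k"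
        using M x order_trans by (fastforce simp: A_def)
      then show ?thesis by blast
    qed
    then show ?thesis
      by (auto simp: A_def)
  qed
  moreover have "mtopology interior_of (carr V) = carr V"
    using interior_of_topspace[of mtopology] by simp
  ultimately have "mtopology interior_of \<Union>(range A) \<noteq> {}"
    using zero_in by (metis empty_iff)
  then obtain k where "mtopology interior_of (A k) \<noteq> {}"
    using metric_Baire_category_alt[OF mcomplete countable_image[OF countableI_type], of A UNIV] closed
    by blast
  then obtain x where "x \<in> mtopology interior_of (A k)"
    by blast
  then obtain U where U: "openin mtopology U" "x \<in> U" "U \<subseteq> A k"
    by (auto simp: interior_of_def)
  then obtain r where r: "0 < r" "mball x r \<subseteq> A k"
    unfolding openin_mtopology by blast
  have x: "x \<in> A k" "x \<in> carr V"
    using U by (auto simp: A_def)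
  show ?thesis
  proof (rule that)
    show "0 \<le> 4 * real k / r"
      using r by simp
    fix n y assume y: "y \<in> carr V"
    show "hnorm V (S n y) \<le> 4 * real k / r * hnorm V y"
    proof (cases "y = 0")
      case True
      then show ?thesis
        using linear_op_zero[OF _ VV, of V "S n"] S[of n] by (simp add: bounded_op_def)
    next
      case False
      then have ny: "0 < hnorm V y"
        using hnorm_eq_0[OF y] hnorm_nonneg[OF y] by linarith
      \<comment> \<open>This scaling gives \<open>z\<close> norm r / 2, so \<open>x + z\<close>
        stays in the ball. Writing \<open>S n z\<close> as a difference of two values bounded by
        \<open>k\<close> gives norm at most 2 k, and dividing by \<open>t\<close> produces the
        constant 4 k / r.\<close>
      define t where "t = r / (2 * hnorm V y)"
      have t: "0 < t"
        using r ny by (simp add: t_def)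
      define z where "z = of_real t *\<^sub>C y"
      have z: "z \<in> carr V"
        using y by (simp add: z_def)
      have nz: "hnorm V z = r / 2"
        using y ny t r by (simp add: z_def hnorm_scaleC) (simp add: t_def)
      have "x + z \<in> mball x r"
        using x z nz r hnorm_minus[OF z] by (simp add: hdist_def)
      then have "hnorm V (S n (x + z)) \<le> real k"
        using r by (auto simp: A_def)
      moreover have "hnorm V (S n x) \<le> real k"
        using x by (simp add: A_def)
      moreover have "S n z = S n (x + z) - S n x"
        using bounded_op_add[OF S x(2) z] by simp
      ultimately have "hnorm V (S n z) \<le> 2 * real k"
        using hnorm_triangle_diff[OF bounded_op_in[OF S add_in[OF x(2) z]] bounded_op_in[OF S x(2)], of n n]
        by simp
      moreover have "hnorm V (S n z) = t * hnorm V (S n y)"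
        using t bounded_op_in[OF S y] by (simp add: z_def bounded_op_scaleC[OF S y] hnorm_scaleC)
      ultimately show ?thesis
        using r ny by (simp add: t_def field_simps)
    qed
  qed
qed

text \<open>Replacing \<open>x\<close> by \<open>d m\<close> costs at most (B + C) times their
  distance, uniformly in \<open>n\<close>, where C bounds \<open>P\<close>; for fixed
  \<open>m\<close> convergence is assumed.\<close>

lemma conv_if_dense:
  assumes S: "\<And>n. bounded_op V V (S n)" "\<And>n x. x \<in> carr V \<Longrightarrow> hnorm V (S n x) \<le> B * hnorm V x" "0 \<le> B"
    and P: "bounded_op V V P"
    and d: "\<And>n. d n \<in> carr V" "conv d x" "\<And>m. conv (\<lambda>n. S n (d m)) (P (d m))"
  shows "conv (\<lambda>n. S n x) (P x)"
proof -
  have VV: "inner_space V"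
    by (rule inner_space_axioms)
  obtain C where C: "0 \<le> C" "\<And>x. x \<in> carr V \<Longrightarrow> hnorm V (P x) \<le> C * hnorm V x"
    using bounded_op_bound[OF P VV] by metis
  have x: "x \<in> carr V"
    using convD(2)[OF d(2)] .
  have "(\<lambda>n. hnorm V (S n x - P x)) \<longlonglongrightarrow> 0"
  proof (rule LIMSEQ_I)
    fix \<epsilon> :: real assume \<epsilon>: "0 < \<epsilon>"
    \<comment> \<open>The extra 1 makes the denominator positive even if
      \<open>B = C = 0\<close>.\<close>
    define \<delta> where "\<delta> = \<epsilon> / (2 * (B + C + 1))"
    have \<delta>: "0 < \<delta>"
      using \<epsilon> S(3) C(1) by (simp add: \<delta>_def)
    obtain m where m: "hnorm V (d m - x) < \<delta>"
      using LIMSEQ_D[OF convD(3)[OF d(2)] \<delta>] d(1) x by auto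
    obtain N where N: "\<And>n. N \<le> n \<Longrightarrow> hnorm V (S n (d m) - P (d m)) < \<epsilon> / 2"
    proof -
      obtain N where N: "\<And>n. N \<le> n \<Longrightarrow> norm (hnorm V (S n (d m) - P (d m)) - 0) < \<epsilon> / 2"
        using LIMSEQ_D[OF convD(3)[OF d(3)], of "\<epsilon> / 2" m] \<epsilon> by auto
      have "hnorm V (S n (d m) - P (d m)) < \<epsilon> / 2" if "N \<le> n" for n
        using N[OF that] by simp
      then show ?thesis using that by blast
    qed
    have "norm (hnorm V (S n x - P x) - 0) < \<epsilon>" if n: "N \<le> n" for n
    proof -
      define y where "y = d m - x"
      have y: "y \<in> carr V"
        using d(1) x by (simp add: y_def)
      have i: "S n y \<in> carr V" "P y \<in> carr V" "S n (d m) \<in> carr V" "P (d m) \<in> carr V"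
        "S n x \<in> carr V" "P x \<in> carr V"
        using y d(1) x by (auto intro: bounded_op_in[OF S(1)] bounded_op_in[OF P])
      have "S n x - P x = (S n (d m) - P (d m)) + (P y - S n y)"
        using bounded_op_diff[OF S(1) VV d(1) x] bounded_op_diff[OF P VV d(1) x]
        by (simp add: y_def)
      then have "hnorm V (S n x - P x) \<le> hnorm V (S n (d m) - P (d m)) + (hnorm V (P y) + hnorm V (S n y))"
        using hnorm_triangle[of "S n (d m) - P (d m)" "P y - S n y"] hnorm_triangle_diff[of "P y" "S n y"] i
        by simp
      also have "\<dots> < \<epsilon> / 2 + (C * \<delta> + B * \<delta>)"
      proof -
        have "hnorm V (P y) \<le> C * \<delta>" "hnorm V (S n y) \<le> B * \<delta>"
          using order_trans[OF C(2)[OF y] mult_left_mono[OF _ C(1)], of \<delta>]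
            order_trans[OF S(2)[OF y] mult_left_mono[OF _ S(3)], of \<delta> n] m by (simp_all add: y_def)
        then show ?thesis
          using N[OF n] by linarith
      qed
      also have "\<dots> \<le> \<epsilon>"
      proof -
        have "(C + B) * \<delta> \<le> (B + C + 1) * \<delta>"
          using \<delta> by (intro mult_right_mono) auto
        also have "\<dots> = \<epsilon> / 2"
        proof -
          have "B + C + 1 \<noteq> 0"
            using S(3) C(1) by linarith
          then show ?thesis
            unfolding \<delta>_def by (metis divide_divide_eq_left' nonzero_mult_div_cancel_left times_divide_eq_right)
        qed
        finally show ?thesis
          by (simp add: algebra_simps)
      qed
      finally show ?thesis
        using i by simp
    qed
    then show "\<exists>N. \<forall>n\<ge>N. norm (hnorm V (S n x - P x) - 0) < \<epsilon>"
      by blast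
  qed
  then show ?thesis
    using x by (auto simp: conv_def intro: bounded_op_in[OF S(1)] bounded_op_in[OF P])
qed

end

section \<open>Operator tuples and the powers of \<open>sigma\<close>\<close>

locale op_tuple = hilb V for V :: "'a::complex_vector hspace" +
  fixes T :: "'d::finite \<Rightarrow> 'a \<Rightarrow> 'a"
  assumes T: "bounded_op V V (T i)"
begin

lemmas inner = inner_space_axioms
lemmas T_in [simp] = bounded_op_in[OF T]
lemmas Tadj_in [simp] = adj_in[OF T inner]
lemmas Tadj = bounded_op_adj[OF T inner]

lemma bounded_op_sigma: "bounded_op V V X \<Longrightarrow> bounded_op V V (sigma V T X)"
  unfolding sigma_def
  by (intro bounded_op_sum_fun inner bounded_op_compose[OF bounded_op_compose[OF Tadj] T]) auto

lemma bounded_op_sigma_power: "bounded_op V V ((sigma V T ^^ n) (\<lambda>y. y))"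
  by (induction n) (auto intro: bounded_op_id bounded_op_sigma)

lemmas sigma_power_in [simp] = bounded_op_in[OF bounded_op_sigma_power]

lemma sigma_power_Suc:
  "(sigma V T ^^ Suc n) (\<lambda>y. y) x = (\<Sum>i\<in>UNIV. T i ((sigma V T ^^ n) (\<lambda>y. y) (adj V V (T i) x)))"
  by (simp add: sigma_def)

text \<open>In this form the recursion involves only the adjoints of the \<open>T i\<close>. These
  are the operators that a dilation intertwines and that have kernel functions as
  eigenvectors.\<close>

lemma ip_sigma_power_Suc:
  assumes "x \<in> carr V" "y \<in> carr V"
  shows "ip V ((sigma V T ^^ Suc n) (\<lambda>y. y) x) y
    = (\<Sum>i\<in>UNIV. ip V ((sigma V T ^^ n) (\<lambda>y. y) (adj V V (T i) x)) (adj V V (T i) y))"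
  unfolding sigma_power_Suc
  by (subst ip_sum_left) (simp_all add: assms ip_adj[OF T inner])

end

section \<open>Vector-valued functional Hilbert spaces\<close>

lemma hilb_complex_hspace: "hilb complex_hspace"
  by (rule hilbI[OF hilbert_space_complex_hspace])

lemma csubspace_diff: "csubspace S \<Longrightarrow> x \<in> S \<Longrightarrow> y \<in> S \<Longrightarrow> x - y \<in> S"
  unfolding csubspace_def by (metis add_uminus_conv_diff scaleC_minus1)

lemma complex_hspace_simps [simp]:
  "carr complex_hspace = UNIV" "ip complex_hspace x y = x * cnj y" "hnorm complex_hspace x = cmod x"
  by (simp_all add: complex_hspace_def hnorm_def cmod_def power2_eq_square)

text \<open>The Schur product theorem, proved by one Gram-Schmidt step per index: the part along
  \<open>e p\<close> is a rank-one matrix, covered by the hypothesis, and the remainder no longer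
  involves the index \<open>p\<close>, so the induction hypothesis applies.\<close>

lemma positive_semidefinite_tensor_Gram:
  fixes r :: "'i \<Rightarrow> 'i \<Rightarrow> complex"
  assumes "inner_space E" "finite L"
    and pos: "\<And>t. 0 \<le> Re (\<Sum>l\<in>L. \<Sum>m\<in>L. r l m * (t l * cnj (t m)))"
    and e: "\<And>l. l \<in> L \<Longrightarrow> e l \<in> carr E"
  shows "0 \<le> Re (\<Sum>l\<in>L. \<Sum>m\<in>L. r l m * ip E (e l) (e m))"
  using assms(2) pos e
proof (induction L arbitrary: e rule: finite_induct)
  case (insert p L)
  interpret E: inner_space E by fact
  \<comment> \<open>Positivity passes to the smaller index set by giving the index \<open>p\<close>
    the coefficient 0.\<close>
  have sub: "0 \<le> Re (\<Sum>l\<in>L. \<Sum>m\<in>L. r l m * (t l * cnj (t m)))" for t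
  proof -
    have "(\<Sum>l\<in>insert p L. \<Sum>m\<in>insert p L. r l m * ((t(p := 0)) l * cnj ((t(p := 0)) m)))
      = (\<Sum>l\<in>L. \<Sum>m\<in>L. r l m * (t l * cnj (t m)))"
      using insert.hyps by (simp, intro sum.cong refl) auto
    then show ?thesis
      using insert.prems(1)[of "t(p := 0)"] by simp
  qed
  have ep: "e p \<in> carr E"
    using insert.prems(2) by simp
  define n where "n = hnorm E (e p)"
  \<comment> \<open>If \<open>e p = 0\<close>, then \<open>n = 0\<close>, and division by zero makes
    \<open>t\<close> vanish and \<open>e'\<close> equal to \<open>e\<close>; the splitting below
    remains correct.\<close>
  define t where "t l = ip E (e l) (e p) / of_real n" for l
  define e' where "e' l = e l - (t l / of_real n) *\<^sub>C e p" for l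
  have e': "e' l \<in> carr E" if "l \<in> insert p L" for l
    using insert.prems(2) that ep by (simp add: e'_def)
  have np: "ip E (e p) (e p) = of_real n * of_real n"
    using E.ip_self[OF ep] by (simp add: n_def power2_eq_square)
  \<comment> \<open>Split off the component along \<open>e p\<close>; what remains has \<open>e' p = 0\<close>.\<close>
  have split: "ip E (e l) (e m) = t l * cnj (t m) + ip E (e' l) (e' m) \<and> e' p = 0"
    if "l \<in> insert p L" "m \<in> insert p L" for l m
  proof (cases "n = 0")
    case True
    then have "e p = 0"
      using E.hnorm_eq_0[OF ep] by (simp add: n_def)
    then show ?thesis
      using True by (simp add: e'_def t_def)
  next
    case False
    have lm: "e l \<in> carr E" "e m \<in> carr E"
      using insert.prems(2) that by auto
    have "ip E (e l) (e p) = t l * of_real n" "ip E (e p) (e m) = cnj (t m) * of_real n"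
      using False E.ip_cnj[OF lm(2) ep] by (simp_all add: t_def)
    then have "ip E (e' l) (e' m) = ip E (e l) (e m) - t l * cnj (t m)"
      using False lm ep
      by (simp add: e'_def E.ip_diff_left E.ip_diff_right E.ip_scaleC_left E.ip_scaleC_right np)
    moreover have "e' p = 0"
      using False by (simp add: e'_def t_def np scaleC_one)
    ultimately show ?thesis by simp
  qed
  have e'p: "e' p = 0"
    using split by blast
  have "(\<Sum>l\<in>insert p L. \<Sum>m\<in>insert p L. r l m * ip E (e l) (e m))
    = (\<Sum>l\<in>insert p L. \<Sum>m\<in>insert p L. r l m * (t l * cnj (t m)) + r l m * ip E (e' l) (e' m))"
    by (intro sum.cong refl) (simp add: split distrib_left)
  also have "\<dots> = (\<Sum>l\<in>insert p L. \<Sum>m\<in>insert p L. r l m * (t l * cnj (t m)))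
    + (\<Sum>l\<in>insert p L. \<Sum>m\<in>insert p L. r l m * ip E (e' l) (e' m))"
    by (simp only: sum.distrib)
  also have "(\<Sum>l\<in>insert p L. \<Sum>m\<in>insert p L. r l m * ip E (e' l) (e' m))
    = (\<Sum>l\<in>L. \<Sum>m\<in>L. r l m * ip E (e' l) (e' m))"
    using insert.hyps e' e'p by simp
  finally show ?case
    using insert.prems(1)[of t] insert.IH[OF sub, of e'] e' by simp
qed simp

locale fhs = hilb F + E: hilb E
  for X :: "'z set" and \<kappa> :: "'z \<Rightarrow> 'z \<Rightarrow> complex"
    and E :: "'e::complex_vector hspace" and F :: "('z \<Rightarrow> 'e) hspace" +
  assumes fhs: "functional_hilbert_space X \<kappa> E F"
begin

definition kern :: "'z \<Rightarrow> 'e \<Rightarrow> 'z \<Rightarrow> 'e" where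
  "kern w x = (\<lambda>z. if z \<in> X then \<kappa> z w *\<^sub>C x else 0)"

lemma value_in: "f \<in> carr F \<Longrightarrow> z \<in> X \<Longrightarrow> f z \<in> carr E"
  and value_off: "f \<in> carr F \<Longrightarrow> z \<notin> X \<Longrightarrow> f z = 0"
  and kern_in: "w \<in> X \<Longrightarrow> x \<in> carr E \<Longrightarrow> kern w x \<in> carr F"
  and ip_kern: "w \<in> X \<Longrightarrow> x \<in> carr E \<Longrightarrow> f \<in> carr F \<Longrightarrow> ip F f (kern w x) = ip E (f w) x"
  using fhs unfolding functional_hilbert_space_def kern_def by auto

lemma value_in': "f \<in> carr F \<Longrightarrow> f z \<in> carr E"
  using value_in[of f z] value_off[of f z] by (cases "z \<in> X") auto

lemma eqI_kern:
  assumes "f \<in> carr F" "g \<in> carr F"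
    and "\<And>w e. w \<in> X \<Longrightarrow> e \<in> carr E \<Longrightarrow> ip F f (kern w e) = ip F g (kern w e)"
  shows "f = g"
proof
  fix z
  show "f z = g z"
  proof (cases "z \<in> X")
    case True
    then show ?thesis
      using assms by (intro E.eqI_ip_left) (simp_all add: value_in ip_kern)
  qed (simp add: assms value_off)
qed

lemma conv_value:
  assumes "conv s f" "e \<in> carr E"
  shows "(\<lambda>n. ip E (s n z) e) \<longlonglongrightarrow> ip E (f z) e"
proof (cases "z \<in> X")
  case True
  then show ?thesis
    using conv_ip_left[OF assms(1) kern_in[OF True assms(2)]] convD[OF assms(1)] assms(2)
    by (simp add: ip_kern)
next
  case False
  then show ?thesis
    using convD[OF assms(1)] by (simp add: value_off)
qed

text \<open>Completeness supplies a limit and the weak limits of the values identify it with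
  \<open>g\<close>. Membership of \<open>g\<close> in \<open>F\<close> is a conclusion: this is how
  explicitly given functions such as \<open>tens h e\<close> and \<open>mul m f\<close> are shown to
  lie in \<open>F\<close>.\<close>

lemma conv_if_Cauchy_pointwise:
  assumes s: "\<And>n. s n \<in> carr F"
    and C: "\<And>\<epsilon>. 0 < \<epsilon> \<Longrightarrow> \<exists>N. \<forall>n\<ge>N. \<forall>m\<ge>N. hnorm F (s n - s m) < \<epsilon>"
    and g: "\<And>z. z \<in> X \<Longrightarrow> g z \<in> carr E" "\<And>z. z \<notin> X \<Longrightarrow> g z = 0"
    and pw: "\<And>z e. z \<in> X \<Longrightarrow> e \<in> carr E \<Longrightarrow> (\<lambda>n. ip E (s n z) e) \<longlonglongrightarrow> ip E (g z) e"
  shows "conv s g"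
proof -
  obtain f where f: "conv s f"
    using conv_if_Cauchy[of s, OF s C] by metis
  have "f z = g z" for z
  proof (cases "z \<in> X")
    case True
    show ?thesis
    proof (rule E.eqI_ip_left)
      show "ip E (f z) e = ip E (g z) e" if "e \<in> carr E" for e
        using LIMSEQ_unique[OF conv_value[OF f that] pw[OF True that]] .
    qed (use True g convD(2)[OF f] value_in in auto)
  next
    case False
    then show ?thesis
      using g convD(2)[OF f] value_off by simp
  qed
  then show ?thesis
    using f by (metis ext)
qed

lemma Cauchy_if_conv_dominated:
  assumes s: "inner_space.conv V s x" and V: "inner_space V"
    and le: "\<And>n m. hnorm F (t n - t m) \<le> B * hnorm V (s n - s m)" and B: "0 \<le> B" and \<epsilon>: "0 < \<epsilon>"
  shows "\<exists>N. \<forall>n\<ge>N. \<forall>m\<ge>N. hnorm F (t n - t m) < \<epsilon>"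
proof -
  interpret V: inner_space V by fact
  note c = V.convD[OF s]
  define \<delta> where "\<delta> = \<epsilon> / (2 * (B + 1))"
  have \<delta>: "0 < \<delta>"
    using B \<epsilon> by (simp add: \<delta>_def)
  obtain N where N: "\<And>n. N \<le> n \<Longrightarrow> norm (hnorm V (s n - x) - 0) < \<delta>"
    using LIMSEQ_D[OF c(3) \<delta>] by metis
  have "hnorm F (t n - t m) < \<epsilon>" if "N \<le> n" "N \<le> m" for n m
  proof -
    have "hnorm V (s n - s m) \<le> hnorm V (s n - x) + hnorm V (s m - x)"
      using V.hnorm_triangle_diff[of "s n - x" "s m - x"] c(1,2) by simp
    then have "hnorm V (s n - s m) \<le> 2 * \<delta>"
      using N[OF that(1)] N[OF that(2)] by simp
    then have "hnorm F (t n - t m) \<le> B * (2 * \<delta>)"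
      using order_trans[OF le mult_left_mono[OF _ B]] by blast
    also have "\<dots> < (B + 1) * (2 * \<delta>)"
      using \<delta> by simp
    also have "\<dots> = \<epsilon>"
    proof -
      have "B + 1 \<noteq> 0"
        using B by linarith
      then show ?thesis
        by (simp add: \<delta>_def field_simps)
    qed
    finally show ?thesis .
  qed
  then show ?thesis
    by blast
qed

end

section \<open>Elementary tensors \<open>tens h e\<close> and slices\<close>

definition tens :: "('z \<Rightarrow> complex) \<Rightarrow> 'e::complex_vector \<Rightarrow> 'z \<Rightarrow> 'e" where
  "tens h e = (\<lambda>z. h z *\<^sub>C e)"

text \<open>As a map of \<open>f\<close>, this is the adjoint of
  \<open>\<lambda>h. tens h e\<close>; see \<open>ip_slice\<close>.\<close>

definition slice :: "'e::complex_vector hspace \<Rightarrow> ('z \<Rightarrow> 'e) \<Rightarrow> 'e \<Rightarrow> 'z \<Rightarrow> complex" where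
  "slice E f e = (\<lambda>z. ip E (f z) e)"

lemma tens_add_left: "tens (g + h) e = tens g e + tens h e"
  and tens_scaleC_left: "tens (t *\<^sub>C h) e = t *\<^sub>C tens h e"
  and tens_scaleC_right: "tens h (t *\<^sub>C e) = t *\<^sub>C tens h e"
  and tens_zero_left: "tens 0 e = 0"
  by (simp_all add: tens_def fun_eq_iff scaleC_add_left scaleC_fun_def scaleC_complex_def scaleC_scaleC
      mult.commute)

lemma tens_diff_left: "tens (g - h) e = tens g e - tens h e"
  using tens_add_left[of "g - h" h e] by simp

lemma tens_sum_left: "tens (\<Sum>i\<in>I. h i) e = (\<Sum>i\<in>I. tens (h i) e)"
proof (induction I rule: infinite_finite_induct)
  case (insert i I)
  then show ?case
    by (simp only: sum.insert[OF insert.hyps] tens_add_left insert.IH)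
qed (simp_all only: sum.infinite sum.empty tens_zero_left not_False_eq_True)

locale fhs_pair = H: fhs X \<kappa> complex_hspace H + fhs X \<kappa> E F
  for X :: "'z set" and \<kappa> :: "'z \<Rightarrow> 'z \<Rightarrow> complex" and H :: "('z \<Rightarrow> complex) hspace"
    and E :: "'e::complex_vector hspace" and F :: "('z \<Rightarrow> 'e) hspace"
begin

abbreviation Kw :: "'z \<Rightarrow> 'z \<Rightarrow> complex" where
  "Kw w \<equiv> H.kern w 1"

lemma Kw_in: "w \<in> X \<Longrightarrow> Kw w \<in> carr H"
  by (simp add: H.kern_in)

lemma ip_Kw: "w \<in> X \<Longrightarrow> h \<in> carr H \<Longrightarrow> ip H h (Kw w) = h w"
  by (simp add: H.ip_kern)

lemma tens_Kw: "tens (Kw w) e = kern w e"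
  by (simp add: tens_def kern_def H.kern_def fun_eq_iff scaleC_complex_def)

lemma eqI_Kw:
  assumes "f \<in> carr H" "g \<in> carr H" "\<And>w. w \<in> X \<Longrightarrow> ip H f (Kw w) = ip H g (Kw w)"
  shows "f = g"
proof
  show "f z = g z" for z
    using assms(3)[of z] H.value_off[OF assms(1), of z] H.value_off[OF assms(2), of z]
    by (cases "z \<in> X") (simp_all add: ip_Kw assms(1,2))
qed

text \<open>The product formula is demanded against every \<open>g\<close> whose tensors lie in
  \<open>F\<close>, a condition that does not mention \<open>tensorable\<close> itself. This makes
  the set a subspace, and the choice \<open>g = h\<close> yields the norm identity that makes it
  closed.\<close>

definition tensorable :: "('z \<Rightarrow> complex) set" where
  "tensorable = {h \<in> carr H. (\<forall>e\<in>carr E. tens h e \<in> carr F) \<and>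
    (\<forall>g\<in>carr H. (\<forall>e\<in>carr E. tens g e \<in> carr F) \<longrightarrow>
      (\<forall>e\<in>carr E. \<forall>e'\<in>carr E. ip F (tens g e) (tens h e') = ip H g h * ip E e e'))}"

lemma tensorableD:
  assumes "h \<in> tensorable"
  shows "h \<in> carr H" "e \<in> carr E \<Longrightarrow> tens h e \<in> carr F"
    and "g \<in> carr H \<Longrightarrow> (\<And>e. e \<in> carr E \<Longrightarrow> tens g e \<in> carr F) \<Longrightarrow> e \<in> carr E \<Longrightarrow> e' \<in> carr E \<Longrightarrow>
      ip F (tens g e) (tens h e') = ip H g h * ip E e e'"
  using assms unfolding tensorable_def by blast+

lemma hnorm_tens_tensorable:
  assumes h: "h \<in> tensorable" and e: "e \<in> carr E"
  shows "hnorm F (tens h e) = hnorm E e * hnorm H h"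
proof -
  note D = tensorableD[OF h]
  have "of_real ((hnorm F (tens h e))\<^sup>2) = complex_of_real ((hnorm E e * hnorm H h)\<^sup>2)"
    using D(3)[OF D(1) D(2) e e] unfolding ip_self[OF D(2)[OF e]] H.ip_self[OF D(1)] E.ip_self[OF e]
    by (simp add: power_mult_distrib)
  then have "(hnorm F (tens h e))\<^sup>2 = (hnorm E e * hnorm H h)\<^sup>2"
    by (simp only: of_real_eq_iff)
  then show ?thesis
    by (rule power2_eq_imp_eq) (simp_all add: D e)
qed

lemma tensorable_csubspace: "csubspace tensorable"
  unfolding csubspace_def tensorable_def
  by (auto simp: tens_zero_left tens_add_left tens_scaleC_left H.ip_add_right H.ip_scaleC_right
      ip_add_right ip_scaleC_right distrib_right)

lemma Kw_tensorable: "w \<in> X \<Longrightarrow> Kw w \<in> tensorable"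
  unfolding tensorable_def
  by (auto simp: Kw_in tens_Kw kern_in ip_kern ip_Kw) (simp add: tens_def E.ip_scaleC_left)

text \<open>By the norm identity, applied to differences, \<open>\<lambda>h. tens h e\<close>
  multiplies distances in \<open>tensorable\<close> by the norm of \<open>e\<close>, so Cauchy
  sequences are preserved.\<close>

lemma conv_tens:
  assumes s: "\<And>n. s n \<in> tensorable" and c: "H.conv s h" and e: "e \<in> carr E"
  shows "conv (\<lambda>n. tens (s n) e) (tens h e)"
proof (rule conv_if_Cauchy_pointwise)
  have sH: "s n \<in> carr H" for n
    by (rule tensorableD[OF s])
  show "tens (s n) e \<in> carr F" for n
    by (rule tensorableD(2)[OF s e])
  have le: "hnorm F (tens (s n) e - tens (s m) e) \<le> hnorm E e * hnorm H (s n - s m)" for n m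
    using hnorm_tens_tensorable[OF csubspace_diff[OF tensorable_csubspace s s] e, of n m]
    by (simp only: tens_diff_left)
  show "\<exists>N. \<forall>n\<ge>N. \<forall>m\<ge>N. hnorm F (tens (s n) e - tens (s m) e) < \<epsilon>" if "0 < \<epsilon>" for \<epsilon>
    by (rule Cauchy_if_conv_dominated[OF c H.inner_space_axioms le E.hnorm_nonneg[OF e] that])
  show "(\<lambda>n. ip E (tens (s n) e z) e') \<longlonglongrightarrow> ip E (tens h e z) e'" if e': "e' \<in> carr E" for z e'
    using tendsto_mult_right[OF H.conv_value[OF c, of 1 z], of "ip E e e'"]
    by (simp add: tens_def E.ip_scaleC_left[OF e e'])
  show "tens h e z \<in> carr E" for z
    using e by (simp add: tens_def)
  show "tens h e z = 0" if "z \<notin> X" for z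
    using H.value_off[OF H.convD(2)[OF c] that] by (simp add: tens_def)
qed

text \<open>The kernel functions are tensorable by the reproducing property and total in
  \<open>H\<close>; closedness comes from \<open>conv_tens\<close>.\<close>

lemma tensorable_eq: "tensorable = carr H"
proof (rule H.closed_subspace_eq_carr[OF tensorable_csubspace])
  show "tensorable \<subseteq> carr H"
    using tensorableD by blast
  show "x = 0" if x: "x \<in> carr H" and o: "\<And>u. u \<in> tensorable \<Longrightarrow> ip H u x = 0" for x
  proof (rule eqI_Kw[OF x H.zero_in])
    show "ip H x (Kw w) = ip H 0 (Kw w)" if "w \<in> X" for w
      using o[OF Kw_tensorable[OF that]] H.ip_cnj[OF Kw_in[OF that] x] H.ip_zero_left[OF Kw_in[OF that]]
      by simp
  qed
  fix s h assume s: "\<And>n. s n \<in> tensorable" and c: "H.conv s h"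
  note lim = conv_tens[OF s c]
  have "ip F (tens g e) (tens h e') = ip H g h * ip E e e'"
    if g: "g \<in> carr H" "\<And>e. e \<in> carr E \<Longrightarrow> tens g e \<in> carr F" and e: "e \<in> carr E" "e' \<in> carr E" for g e e'
  proof (rule LIMSEQ_unique)
    show "(\<lambda>n. ip F (tens g e) (tens (s n) e')) \<longlonglongrightarrow> ip F (tens g e) (tens h e')"
      by (rule conv_ip_right[OF lim[OF e(2)] g(2)[OF e(1)]])
    show "(\<lambda>n. ip F (tens g e) (tens (s n) e')) \<longlonglongrightarrow> ip H g h * ip E e e'"
      using tendsto_mult_right[OF H.conv_ip_right[OF c g(1)]] by (simp only: tensorableD(3)[OF s g e])
  qed
  then show "h \<in> tensorable"
    using convD(2)[OF lim] H.convD(2)[OF c] unfolding tensorable_def by blast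
qed

lemma tens_in [simp]: "h \<in> carr H \<Longrightarrow> e \<in> carr E \<Longrightarrow> tens h e \<in> carr F"
  using tensorableD(2) unfolding tensorable_eq .

lemma ip_tens:
  "g \<in> carr H \<Longrightarrow> h \<in> carr H \<Longrightarrow> e \<in> carr E \<Longrightarrow> e' \<in> carr E \<Longrightarrow>
    ip F (tens g e) (tens h e') = ip H g h * ip E e e'"
  using tensorableD(3)[of h g e e'] by (simp add: tensorable_eq)

lemmas hnorm_tens = hnorm_tens_tensorable[unfolded tensorable_eq]

lemma bounded_op_tens: "e \<in> carr E \<Longrightarrow> bounded_op H F (\<lambda>h. tens h e)"
  unfolding bounded_op_def linear_op_def
  by (auto simp: tens_add_left tens_scaleC_left hnorm_tens)

text \<open>Membership in \<open>H\<close> cannot be read off the values. Riesz represents the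
  functional given by \<open>f\<close> on elementary tensors, and testing with \<open>Kw z\<close>
  shows that the representing vector has the values of the slice.\<close>

lemma slice_in: "f \<in> carr F \<Longrightarrow> e \<in> carr E \<Longrightarrow> slice E f e \<in> carr H"
  and ip_slice: "f \<in> carr F \<Longrightarrow> e \<in> carr E \<Longrightarrow> h \<in> carr H \<Longrightarrow> ip H (slice E f e) h = ip F f (tens h e)"
proof -
  assume f: "f \<in> carr F" and e: "e \<in> carr E"
  have bd: "cmod (ip F (tens h e) f) \<le> (hnorm E e * hnorm F f) * hnorm H h" if "h \<in> carr H" for h
    using Cauchy_Schwarz[OF tens_in[OF that e] f] by (simp add: hnorm_tens that e mult_ac)
  obtain v where v: "v \<in> carr H" "\<And>h. h \<in> carr H \<Longrightarrow> ip H h v = ip F (tens h e) f"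
    by (rule H.Riesz[of "\<lambda>h. ip F (tens h e) f" "hnorm E e * hnorm F f"])
      (simp_all add: bd tens_add_left tens_scaleC_left ip_add_left ip_scaleC_left f e)
  have ipv: "ip H v h = ip F f (tens h e)" if "h \<in> carr H" for h
    using v(2)[OF that] H.ip_cnj[OF that v(1)] ip_cnj[OF tens_in[OF that e] f] by simp
  have "v = slice E f e"
  proof
    show "v z = slice E f e z" for z
    proof (cases "z \<in> X")
      case True
      then show ?thesis
        using ipv[OF Kw_in[OF True]] by (simp add: slice_def tens_Kw ip_kern ip_Kw v(1) f e)
    qed (simp add: slice_def H.value_off value_off v(1) f e)
  qed
  then show "slice E f e \<in> carr H"
    and "h \<in> carr H \<Longrightarrow> ip H (slice E f e) h = ip F f (tens h e)"
    using v ipv by auto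
qed

text \<open>Lists keep the chosen representation as a sum of tensors. An ampliation of an operator
  on \<open>H\<close> can then act entry by entry, with no question of dependence on the
  representation.\<close>

definition elementary_sum :: "(('z \<Rightarrow> complex) \<times> 'e) list \<Rightarrow> 'z \<Rightarrow> 'e" where
  "elementary_sum xs = (\<Sum>(h, e)\<leftarrow>xs. tens h e)"

definition elementary_sums :: "('z \<Rightarrow> 'e) set" where
  "elementary_sums = elementary_sum ` lists (carr H \<times> carr E)"

lemma elementary_sum_Nil: "elementary_sum [] = 0"
  by (simp add: elementary_sum_def fun_eq_iff)

lemma elementary_sum_Cons: "elementary_sum (x # xs) = tens (fst x) (snd x) + elementary_sum xs"
  by (simp add: elementary_sum_def case_prod_unfold)

lemma elementary_sum_nth:
  "elementary_sum xs = (\<Sum>i<length xs. tens (fst (xs ! i)) (snd (xs ! i)))"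
  by (simp add: elementary_sum_def sum_list_sum_nth case_prod_unfold atLeast0LessThan)

lemma lists_nth: "xs \<in> lists (carr H \<times> carr E) \<Longrightarrow> i < length xs \<Longrightarrow> fst (xs ! i) \<in> carr H \<and> snd (xs ! i) \<in> carr E"
  by (metis in_lists_conv_set mem_Times_iff nth_mem)

lemma elementary_sums_subset: "elementary_sums \<subseteq> carr F"
proof -
  have "elementary_sum xs \<in> carr F" if "xs \<in> lists (carr H \<times> carr E)" for xs
    unfolding elementary_sum_nth using lists_nth[OF that] by (intro sum_in) auto
  then show ?thesis
    by (auto simp: elementary_sums_def)
qed

lemma elementary_sums_csubspace: "csubspace elementary_sums"
  unfolding csubspace_def
proof (intro conjI ballI allI)
  show "0 \<in> elementary_sums"
    unfolding elementary_sums_def by (rule image_eqI[of _ _ "[]"]) (simp_all add: elementary_sum_def)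
  fix f assume "f \<in> elementary_sums"
  then obtain xs where xs: "xs \<in> lists (carr H \<times> carr E)" "f = elementary_sum xs"
    by (auto simp: elementary_sums_def)
  show "f + g \<in> elementary_sums" if g: "g \<in> elementary_sums" for g
  proof -
    obtain ys where ys: "ys \<in> lists (carr H \<times> carr E)" "g = elementary_sum ys"
      using g by (auto simp: elementary_sums_def)
    show ?thesis
      unfolding elementary_sums_def
      by (rule image_eqI[of _ _ "xs @ ys"]) (use xs ys in \<open>simp_all add: elementary_sum_def\<close>)
  qed
  show "t *\<^sub>C f \<in> elementary_sums" for t
    unfolding elementary_sums_def
  proof (rule image_eqI[of _ _ "map (\<lambda>(h, e). (t *\<^sub>C h, e)) xs"])
    have "t *\<^sub>C elementary_sum xs = elementary_sum (map (\<lambda>(h, e). (t *\<^sub>C h, e)) xs)"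
    proof (induction xs)
      case (Cons x xs)
      then show ?case
        by (simp only: elementary_sum_Cons list.map case_prod_unfold fst_conv snd_conv scaleC_add_right tens_scaleC_left)
    qed (simp only: elementary_sum_Nil list.map scaleC_zero_right)
    then show "t *\<^sub>C f = elementary_sum (map (\<lambda>(h, e). (t *\<^sub>C h, e)) xs)"
      using xs by simp
    show "map (\<lambda>(h, e). (t *\<^sub>C h, e)) xs \<in> lists (carr H \<times> carr E)"
      using xs by (auto simp: in_lists_conv_set)
  qed
qed

lemma elementary_sums_dense:
  assumes "f \<in> carr F"
  obtains s where "\<And>n. s n \<in> elementary_sums" "conv s f"
proof -
  have "x = 0" if x: "x \<in> carr F" and o: "\<And>u. u \<in> elementary_sums \<Longrightarrow> ip F u x = 0" for x
  proof (rule eqI_kern[OF x zero_in])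
    fix w e assume we: "w \<in> X" "e \<in> carr E"
    have "kern w e \<in> elementary_sums"
      unfolding elementary_sums_def
      by (rule image_eqI[of _ _ "[(Kw w, e)]"]) (simp_all add: elementary_sum_def tens_Kw we Kw_in)
    then show "ip F x (kern w e) = ip F 0 (kern w e)"
      using o ip_cnj[OF kern_in[OF we] x] ip_zero_left[OF kern_in[OF we]] by simp
  qed
  from dense_if_ortho_trivial[OF elementary_sums_csubspace elementary_sums_subset this assms] that
  show ?thesis by blast
qed

text \<open>The norm bound for \<open>A\<close> says that the matrix \<open>r\<close> with entries
  B^2 <h_l,h_m> - <A h_l,A h_m> is positive semidefinite, since its quadratic form is B^2 |g|^2 - |A
  g|^2 with g = sum of t_l h_l. Its Schur product with the Gram matrix of the \<open>e l\<close>
  gives the claimed inequality.\<close>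

lemma hnorm_ampliation_le:
  assumes A: "bounded_op H H A" and B: "0 \<le> B" "\<And>h. h \<in> carr H \<Longrightarrow> hnorm H (A h) \<le> B * hnorm H h"
    and xs: "xs \<in> lists (carr H \<times> carr E)"
  shows "hnorm F (elementary_sum (map (\<lambda>(h, e). (A h, e)) xs)) \<le> B * hnorm F (elementary_sum xs)"
proof -
  define h e where "h i = fst (xs ! i)" and "e i = snd (xs ! i)" for i
  define L where "L = {..<length xs}"
  have he: "h i \<in> carr H" "e i \<in> carr E" if "i \<in> L" for i
    using lists_nth[OF xs, of i] that by (auto simp: L_def h_def e_def)
  note A_in = bounded_op_in[OF A]
  define r where "r l m = of_real (B\<^sup>2) * ip H (h l) (h m) - ip H (A (h l)) (A (h m))" for l m
  have sq: "ip F (\<Sum>l\<in>L. tens (u l) (e l)) (\<Sum>l\<in>L. tens (u l) (e l))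
      = (\<Sum>l\<in>L. \<Sum>m\<in>L. ip H (u l) (u m) * ip E (e l) (e m))" if "\<And>l. l \<in> L \<Longrightarrow> u l \<in> carr H" for u
    using that he by (simp add: ip_sum_left ip_sum_right ip_tens) (rule sum.swap)
  have "0 \<le> Re (\<Sum>l\<in>L. \<Sum>m\<in>L. r l m * (t l * cnj (t m)))" for t
  proof -
    define g where "g = (\<Sum>l\<in>L. t l *\<^sub>C h l)"
    have g: "g \<in> carr H"
      using he by (simp add: g_def)
    have Ag: "A g = (\<Sum>l\<in>L. t l *\<^sub>C A (h l))"
      using he by (simp add: g_def bounded_op_sum[OF A H.inner_space_axioms] bounded_op_scaleC[OF A])
    have 1: "ip H g g = (\<Sum>l\<in>L. \<Sum>m\<in>L. ip H (h l) (h m) * (t l * cnj (t m)))"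
      unfolding g_def using he
      by (subst H.ip_sum_left) (auto simp: H.ip_sum_right H.ip_scaleC_left H.ip_scaleC_right
          sum_distrib_left mult_ac intro!: sum.cong)
    have 2: "ip H (A g) (A g) = (\<Sum>l\<in>L. \<Sum>m\<in>L. ip H (A (h l)) (A (h m)) * (t l * cnj (t m)))"
      unfolding Ag using he A_in
      by (subst H.ip_sum_left) (auto simp: H.ip_sum_right H.ip_scaleC_left H.ip_scaleC_right
          sum_distrib_left mult_ac intro!: sum.cong)
    have "(\<Sum>l\<in>L. \<Sum>m\<in>L. r l m * (t l * cnj (t m))) = of_real (B\<^sup>2) * ip H g g - ip H (A g) (A g)"
      unfolding 1 2 r_def by (simp add: sum_distrib_left sum_subtractf left_diff_distrib mult.assoc)
    moreover have "(hnorm H (A g))\<^sup>2 \<le> (B * hnorm H g)\<^sup>2"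
      using B(2)[OF g] H.hnorm_nonneg[OF A_in[OF g]] by (rule power_mono)
    ultimately show ?thesis
      using g A_in[OF g] by (simp add: H.ip_self power_mult_distrib)
  qed
  then have "0 \<le> Re (\<Sum>l\<in>L. \<Sum>m\<in>L. r l m * ip E (e l) (e m))"
    using he by (intro positive_semidefinite_tensor_Gram[OF E.inner_space_axioms]) (auto simp: L_def)
  also have "(\<Sum>l\<in>L. \<Sum>m\<in>L. r l m * ip E (e l) (e m)) = of_real (B\<^sup>2) *
      ip F (\<Sum>l\<in>L. tens (h l) (e l)) (\<Sum>l\<in>L. tens (h l) (e l))
      - ip F (\<Sum>l\<in>L. tens (A (h l)) (e l)) (\<Sum>l\<in>L. tens (A (h l)) (e l))"
    using he A_in
    by (simp add: sq r_def sum_distrib_left sum_subtractf left_diff_distrib mult.assoc)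
  finally have "(hnorm F (\<Sum>l\<in>L. tens (A (h l)) (e l)))\<^sup>2 \<le> (B * hnorm F (\<Sum>l\<in>L. tens (h l) (e l)))\<^sup>2"
    using he A_in by (simp add: ip_self power_mult_distrib)
  then have "hnorm F (\<Sum>l\<in>L. tens (A (h l)) (e l)) \<le> B * hnorm F (\<Sum>l\<in>L. tens (h l) (e l))"
    by (rule power2_le_imp_le) (use he B in auto)
  then show ?thesis
    unfolding elementary_sum_nth by (simp add: L_def h_def e_def case_prod_unfold)
qed

end

section \<open>Multiplication tuples and the defect operator\<close>

definition mul :: "('z \<Rightarrow> complex) \<Rightarrow> ('z \<Rightarrow> 'e::complex_vector) \<Rightarrow> 'z \<Rightarrow> 'e" where
  "mul m f = (\<lambda>z. m z *\<^sub>C f z)"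

lemma mul_tens: "mul m (tens h e) = tens (mul m h) e"
  by (simp add: mul_def tens_def scaleC_scaleC scaleC_complex_def)

lemma mul_add: "mul m (f + g) = mul m f + mul m g"
  and mul_diff: "mul m (f - g) = mul m f - mul m g"
  and mul_scaleC: "mul m (t *\<^sub>C f) = t *\<^sub>C mul m f"
  by (simp_all add: mul_def fun_eq_iff scaleC_add_right scaleC_diff_right scaleC_fun_def scaleC_scaleC
      mult.commute)

text \<open>The partial sums of the series defining 1/K of the tuple.\<close>

definition psum :: "(nat \<Rightarrow> complex) \<Rightarrow> 'a::complex_vector hspace \<Rightarrow> ('d::finite \<Rightarrow> 'a \<Rightarrow> 'a) \<Rightarrow> nat \<Rightarrow> 'a \<Rightarrow> 'a" where
  "psum c V T N x = (\<Sum>n<N. c n *\<^sub>C (sigma V T ^^ n) (\<lambda>y. y) x)"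

text \<open>Words fit the recursion of \<open>sigma\<close> over single coordinates. For the
  coordinate multiplications on \<open>H_K\<close>, the value of such a word at the origin is an
  inner product with a monomial.\<close>

definition adj_word :: "'a hspace \<Rightarrow> ('d \<Rightarrow> 'a \<Rightarrow> 'a) \<Rightarrow> 'd list \<Rightarrow> 'a \<Rightarrow> 'a" where
  "adj_word V T I x = foldl (\<lambda>x i. adj V V (T i) x) x I"

lemma adj_word_simps [simp]:
  "adj_word V T [] x = x"
  "adj_word V T (i # I) x = adj_word V T I (adj V V (T i) x)"
  by (simp_all add: adj_word_def)

context op_tuple
begin

lemma adj_word_in [simp]: "x \<in> carr V \<Longrightarrow> adj_word V T I x \<in> carr V"
  by (induction I arbitrary: x) auto

lemma bounded_op_psum: "bounded_op V V (psum c V T N)"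
  unfolding psum_def
  by (intro bounded_op_sum_fun bounded_op_scale bounded_op_sigma_power inner)

end

section \<open>Multiplication operators on vector-valued functions\<close>

context fhs_pair
begin

lemma mul_elementary_sum:
  "mul m (elementary_sum xs) = elementary_sum (map (\<lambda>(h, e). (mul m h, e)) xs)"
proof (induction xs)
  case Nil
  show ?case
    by (simp add: elementary_sum_def mul_def fun_eq_iff)
next
  case (Cons x xs)
  then show ?case
    by (simp only: elementary_sum_Cons list.map case_prod_unfold fst_conv snd_conv mul_add mul_tens)
qed

lemma elementary_sums_mem:
  assumes "f \<in> elementary_sums"
  obtains xs where "xs \<in> lists (carr H \<times> carr E)" "f = elementary_sum xs"
  using assms by (auto simp: elementary_sums_def)

lemma lists_map_fst:
  assumes "\<And>h. h \<in> carr H \<Longrightarrow> A h \<in> carr H" "xs \<in> lists (carr H \<times> carr E)"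
  shows "map (\<lambda>(h, e). (A h, e)) xs \<in> lists (carr H \<times> carr E)"
  using assms by (auto simp: in_lists_conv_set)

lemma hnorm_le_if_elementary_sums:
  assumes A: "bounded_op F F A"
    and le: "\<And>u. u \<in> elementary_sums \<Longrightarrow> hnorm F (A u) \<le> B * hnorm F u" and f: "f \<in> carr F"
  shows "hnorm F (A f) \<le> B * hnorm F f"
proof -
  obtain s where s: "\<And>n. s n \<in> elementary_sums" "conv s f"
    by (rule elementary_sums_dense[OF f]) blast
  show ?thesis
  proof (rule LIMSEQ_le)
    show "(\<lambda>n. hnorm F (A (s n))) \<longlonglongrightarrow> hnorm F (A f)"
      by (rule conv_hnorm[OF bounded_op_conv[OF A inner_space_axioms inner_space_axioms s(2)]])
    show "(\<lambda>n. B * hnorm F (s n)) \<longlonglongrightarrow> B * hnorm F f"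
      by (rule tendsto_mult_left[OF conv_hnorm[OF s(2)]])
  qed (use le s(1) in blast)
qed

lemma slice_mul: "f \<in> carr F \<Longrightarrow> e \<in> carr E \<Longrightarrow> slice E (mul m f) e = mul m (slice E f e)"
  by (simp add: slice_def mul_def fun_eq_iff E.ip_scaleC_left value_in' scaleC_complex_def)

text \<open>On elementary sums, multiplication by \<open>m\<close> is the ampliation of its scalar
  version and has the same bound. Convergence of values shows that the extension by density is again
  multiplication by \<open>m\<close>.\<close>

lemma bounded_op_mul:
  assumes m: "bounded_op H H (mul m)"
  shows "bounded_op F F (mul m)"
proof -
  obtain B where B: "0 \<le> B" "\<And>h. h \<in> carr H \<Longrightarrow> hnorm H (mul m h) \<le> B * hnorm H h"
    using bounded_op_bound[OF m H.inner_space_axioms] by metis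
  have el: "mul m u \<in> carr F \<and> hnorm F (mul m u) \<le> B * hnorm F u" if u: "u \<in> elementary_sums" for u
  proof -
    obtain xs where xs: "xs \<in> lists (carr H \<times> carr E)" "u = elementary_sum xs"
      using elementary_sums_mem[OF u] .
    have "elementary_sum (map (\<lambda>(h, e). (mul m h, e)) xs) \<in> elementary_sums"
      unfolding elementary_sums_def by (intro imageI lists_map_fst bounded_op_in[OF m] xs(1))
    then show ?thesis
      using hnorm_ampliation_le[OF m B xs(1)] elementary_sums_subset
      unfolding xs(2) mul_elementary_sum by blast
  qed
  have main: "mul m f \<in> carr F \<and> hnorm F (mul m f) \<le> B * hnorm F f" if f: "f \<in> carr F" for f
  proof -
    obtain s where s: "\<And>n. s n \<in> elementary_sums" "conv s f"
      by (rule elementary_sums_dense[OF f]) blast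
    have c: "conv (\<lambda>n. mul m (s n)) (mul m f)"
    proof (rule conv_if_Cauchy_pointwise)
      have le: "hnorm F (mul m (s n) - mul m (s k)) \<le> B * hnorm F (s n - s k)" for n k
        using el[OF csubspace_diff[OF elementary_sums_csubspace s(1) s(1)], of n k] by (simp only: mul_diff)
      show "\<exists>N. \<forall>n\<ge>N. \<forall>k\<ge>N. hnorm F (mul m (s n) - mul m (s k)) < \<epsilon>" if "0 < \<epsilon>" for \<epsilon>
        by (rule Cauchy_if_conv_dominated[OF s(2) inner_space_axioms le B(1) that])
      show "(\<lambda>n. ip E (mul m (s n) z) e) \<longlonglongrightarrow> ip E (mul m f z) e" if "z \<in> X" "e \<in> carr E" for z e
        using tendsto_mult_left[OF conv_value[OF s(2) that(2)], of "m z" z] that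
        by (simp add: mul_def E.ip_scaleC_left value_in' f convD(1)[OF s(2)])
      show "mul m (s n) \<in> carr F" for n
        using el[OF s(1)] by blast
    qed (use f in \<open>simp_all add: mul_def value_in value_off\<close>)
    have "hnorm F (mul m f) \<le> B * hnorm F f"
      by (rule LIMSEQ_le[OF conv_hnorm[OF c] tendsto_mult_left[OF conv_hnorm[OF s(2)]]])
        (use el s(1) in blast)
    then show ?thesis
      using convD(2)[OF c] by blast
  qed
  then show ?thesis
    unfolding bounded_op_def linear_op_def by (auto simp: mul_add mul_scaleC)
qed

text \<open>The map \<open>\<lambda>h. tens h e\<close> intertwines the two multiplication operators
  (\<open>mul_tens\<close>); taking adjoints gives the claim.\<close>

lemma slice_adj_mul:
  assumes m: "bounded_op H H (mul m)" and f: "f \<in> carr F" and e: "e \<in> carr E"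
  shows "slice E (adj F F (mul m) f) e = adj H H (mul m) (slice E f e)"
proof (rule H.eqI_ip_left)
  note mF = bounded_op_mul[OF m]
  note aF = adj_in[OF mF inner_space_axioms f]
  note sl = slice_in[OF f e]
  show "slice E (adj F F (mul m) f) e \<in> carr H"
    by (rule slice_in[OF aF e])
  show "adj H H (mul m) (slice E f e) \<in> carr H"
    by (rule H.adj_in[OF m H.inner_space_axioms sl])
  show "ip H (slice E (adj F F (mul m) f) e) h = ip H (adj H H (mul m) (slice E f e)) h"
    if h: "h \<in> carr H" for h
    unfolding ip_slice[OF aF e h] H.ip_adj_left[OF m H.inner_space_axioms sl h]
      ip_adj_left[OF mF inner_space_axioms f tens_in[OF h e]] mul_tens
      ip_slice[OF f e bounded_op_in[OF m h]] ..
qed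

lemma adj_mul_tens:
  assumes m: "bounded_op H H (mul m)" and h: "h \<in> carr H" and e: "e \<in> carr E"
  shows "adj F F (mul m) (tens h e) = tens (adj H H (mul m) h) e"
proof (rule eqI_kern)
  note mF = bounded_op_mul[OF m]
  note ah = H.adj_in[OF m H.inner_space_axioms h]
  show "adj F F (mul m) (tens h e) \<in> carr F"
    by (rule adj_in[OF mF inner_space_axioms tens_in[OF h e]])
  show "tens (adj H H (mul m) h) e \<in> carr F"
    by (rule tens_in[OF ah e])
  fix w e' assume w: "w \<in> X" and e': "e' \<in> carr E"
  show "ip F (adj F F (mul m) (tens h e)) (kern w e') = ip F (tens (adj H H (mul m) h) e) (kern w e')"
    unfolding tens_Kw[symmetric] ip_tens[OF ah Kw_in[OF w] e e']
      ip_adj_left[OF mF inner_space_axioms tens_in[OF h e] tens_in[OF Kw_in[OF w] e']] mul_tens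
      ip_tens[OF h bounded_op_in[OF m Kw_in[OF w]] e e'] H.ip_adj_left[OF m H.inner_space_axioms h Kw_in[OF w]] ..
qed

text \<open>By the reproducing property, both sides pair with \<open>u\<close> to
  \<open>m w * u w\<close>. This eigenvector relation turns the operator series into scalar power
  series.\<close>

lemma adj_mul_Kw:
  assumes m: "bounded_op H H (mul m)" and w: "w \<in> X"
  shows "adj H H (mul m) (Kw w) = cnj (m w) *\<^sub>C Kw w"
proof (rule H.eqI_ip)
  note K = Kw_in[OF w]
  fix u assume u: "u \<in> carr H"
  show "ip H u (adj H H (mul m) (Kw w)) = ip H u (cnj (m w) *\<^sub>C Kw w)"
    unfolding H.ip_adj[OF m H.inner_space_axioms K u] ip_Kw[OF w bounded_op_in[OF m u]]
      H.ip_scaleC_right[OF K u] ip_Kw[OF w u] by (simp add: mul_def scaleC_complex_def)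
qed (simp_all add: Kw_in[OF w] H.adj_in[OF m H.inner_space_axioms])

end

locale mult_tuple = fhs_pair X \<kappa> H E F
  for X :: "'z set" and \<kappa> :: "'z \<Rightarrow> 'z \<Rightarrow> complex" and H :: "('z \<Rightarrow> complex) hspace"
    and E :: "'e::complex_vector hspace" and F :: "('z \<Rightarrow> 'e) hspace" +
  fixes m :: "'d::finite \<Rightarrow> 'z \<Rightarrow> complex"
  assumes mul_bounded: "bounded_op H H (mul (m i))"
begin

sublocale HT: op_tuple H "\<lambda>i. mul (m i)"
  by unfold_locales (rule mul_bounded)

sublocale FT: op_tuple F "\<lambda>i. mul (m i)"
  by unfold_locales (rule bounded_op_mul[OF mul_bounded])

abbreviation MH :: "'d \<Rightarrow> ('z \<Rightarrow> complex) \<Rightarrow> 'z \<Rightarrow> complex" where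
  "MH \<equiv> \<lambda>i. mul (m i)"

abbreviation MF :: "'d \<Rightarrow> ('z \<Rightarrow> 'e) \<Rightarrow> 'z \<Rightarrow> 'e" where
  "MF \<equiv> \<lambda>i. mul (m i)"

lemma slice_adj_word:
  "f \<in> carr F \<Longrightarrow> e \<in> carr E \<Longrightarrow> slice E (adj_word F MF I f) e = adj_word H MH I (slice E f e)"
  by (induction I arbitrary: f) (simp_all add: slice_adj_mul[OF mul_bounded])

text \<open>Hence \<open>psum\<close> on \<open>F\<close> is the ampliation of \<open>psum\<close>
  on \<open>H\<close>, and \<open>hnorm_ampliation_le\<close> transfers its bounds.\<close>

lemma sigma_power_tens:
  assumes "h \<in> carr H" "e \<in> carr E"
  shows "(sigma F MF ^^ n) (\<lambda>y. y) (tens h e) = tens ((sigma H MH ^^ n) (\<lambda>y. y) h) e"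
  using assms(1)
proof (induction n arbitrary: h)
  case (Suc n)
  have "(sigma F MF ^^ n) (\<lambda>y. y) (adj F F (MF i) (tens h e))
    = tens ((sigma H MH ^^ n) (\<lambda>y. y) (adj H H (MH i) h)) e" for i
    unfolding adj_mul_tens[OF mul_bounded Suc.prems assms(2)]
    by (rule Suc.IH[OF HT.Tadj_in[OF Suc.prems]])
  then show ?case
    by (simp only: FT.sigma_power_Suc HT.sigma_power_Suc tens_sum_left mul_tens)
qed simp

lemma psum_tens:
  assumes "h \<in> carr H" "e \<in> carr E"
  shows "psum c F MF N (tens h e) = tens (psum c H MH N h) e"
  by (simp only: psum_def sigma_power_tens[OF assms] tens_sum_left tens_scaleC_left)

lemma psum_elementary_sum:
  assumes "xs \<in> lists (carr H \<times> carr E)"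
  shows "psum c F MF N (elementary_sum xs) = elementary_sum (map (\<lambda>(h, e). (psum c H MH N h, e)) xs)"
  using assms
proof (induction xs rule: list.induct)
  case Nil
  then show ?case
    using linear_op_zero[of F F "psum c F MF N"] FT.bounded_op_psum inner_space_axioms
    unfolding bounded_op_def by (simp only: elementary_sum_Nil list.map)
next
  case (Cons x xs)
  have xs': "xs \<in> lists (carr H \<times> carr E)" and x: "fst x \<in> carr H" "snd x \<in> carr E"
    using Cons.prems unfolding Cons_in_lists_iff mem_Times_iff by blast+
  have xs: "elementary_sum xs \<in> carr F"
    using xs' elementary_sums_subset unfolding elementary_sums_def by blast
  show ?case
    by (simp only: elementary_sum_Cons list.map case_prod_unfold fst_conv snd_conv psum_tens[OF x]
        bounded_op_add[OF FT.bounded_op_psum tens_in[OF x] xs] Cons.IH[OF xs'])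
qed

text \<open>Each application of \<open>sigma\<close> contributes one pair of eigenvalues per
  coordinate, hence the factor that is <z,w> for the coordinate functions.\<close>

lemma ip_sigma_power_Kw:
  assumes "w \<in> X" "z \<in> X"
  shows "ip H ((sigma H MH ^^ n) (\<lambda>y. y) (Kw w)) (Kw z) = (\<Sum>i\<in>UNIV. m i z * cnj (m i w)) ^ n * \<kappa> z w"
proof (induction n)
  case 0
  show ?case
    using ip_Kw[OF assms(2) Kw_in[OF assms(1)]] assms by (simp add: H.kern_def scaleC_complex_def)
next
  case (Suc n)
  have "ip H ((sigma H MH ^^ n) (\<lambda>y. y) (adj H H (MH i) (Kw w))) (adj H H (MH i) (Kw z))
    = (m i z * cnj (m i w)) * ((\<Sum>i\<in>UNIV. m i z * cnj (m i w)) ^ n * \<kappa> z w)" for i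
    unfolding adj_mul_Kw[OF mul_bounded assms(1)] adj_mul_Kw[OF mul_bounded assms(2)]
    using assms Suc
    by (simp add: bounded_op_scaleC[OF HT.bounded_op_sigma_power] H.ip_scaleC_left H.ip_scaleC_right Kw_in)
  note step = this
  show ?case
    unfolding HT.ip_sigma_power_Suc[OF Kw_in[OF assms(1)] Kw_in[OF assms(2)]]
    by (simp only: step sum_distrib_right[symmetric]) simp
qed

end

text \<open>Abstracts the ball: there \<open>p\<close> is the origin, \<open>a_sums\<close> expands
  k(<z,w>), and \<open>c_sums\<close> is the identity (1/k) k = 1. The normalisation at
  \<open>p\<close> makes \<open>Kw p\<close> the constant function 1 on \<open>X\<close>, so
  \<open>tens (Kw p) e\<close> is the constant function \<open>e\<close> there.\<close>

locale unital_kernel = mult_tuple X \<kappa> H E F m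
  for X :: "'z set" and \<kappa> :: "'z \<Rightarrow> 'z \<Rightarrow> complex" and H :: "('z \<Rightarrow> complex) hspace"
    and E :: "'e::complex_vector hspace" and F :: "('z \<Rightarrow> 'e) hspace" and m :: "'d::finite \<Rightarrow> 'z \<Rightarrow> complex" +
  fixes p :: 'z and a :: "nat \<Rightarrow> real" and c :: "nat \<Rightarrow> complex"
  assumes p: "p \<in> X" and kernel_p: "z \<in> X \<Longrightarrow> \<kappa> p z = 1" "z \<in> X \<Longrightarrow> \<kappa> z p = 1"
    and a_nonneg: "0 \<le> a n"
    and a_sums: "z \<in> X \<Longrightarrow> w \<in> X \<Longrightarrow>
      (\<lambda>n. of_real (a n) * (\<Sum>i\<in>UNIV. m i z * cnj (m i w)) ^ n) sums \<kappa> z w"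
    and c_sums: "z \<in> X \<Longrightarrow> w \<in> X \<Longrightarrow>
      (\<lambda>n. c n * ((\<Sum>i\<in>UNIV. m i z * cnj (m i w)) ^ n * \<kappa> z w)) sums 1"
    and psum_convergent: "h \<in> carr H \<Longrightarrow> \<exists>g. H.conv (\<lambda>N. psum c H MH N h) g"
begin

text \<open>The limit exists by \<open>psum_convergent\<close>, so only its values must be found.
  Its inner product with \<open>Kw z\<close> is the sum in \<open>c_sums\<close>, that is 1.\<close>

lemma conv_psum_Kw:
  assumes w: "w \<in> X"
  shows "H.conv (\<lambda>N. psum c H MH N (Kw w)) (Kw p)"
proof -
  obtain g where g: "H.conv (\<lambda>N. psum c H MH N (Kw w)) g"
    using psum_convergent[OF Kw_in[OF w]] by blast
  have "g = Kw p"
  proof (rule eqI_Kw[OF H.convD(2)[OF g] Kw_in[OF p]])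
    fix z assume z: "z \<in> X"
    have "ip H (psum c H MH N (Kw w)) (Kw z)
      = (\<Sum>n<N. c n * ((\<Sum>i\<in>UNIV. m i z * cnj (m i w)) ^ n * \<kappa> z w))" for N
      unfolding psum_def using w z
      by (simp add: H.ip_sum_left H.ip_scaleC_left Kw_in ip_sigma_power_Kw)
    then have "(\<lambda>N. ip H (psum c H MH N (Kw w)) (Kw z)) \<longlonglongrightarrow> 1"
      using c_sums[OF z w] by (simp add: sums_def)
    then have "ip H g (Kw z) = 1"
      using LIMSEQ_unique H.conv_ip_left[OF g Kw_in[OF z]] by blast
    then show "ip H g (Kw z) = ip H (Kw p) (Kw z)"
      using ip_Kw[OF z Kw_in[OF p]] z by (simp add: H.kern_def scaleC_complex_def kernel_p)
  qed
  then show ?thesis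
    using g by simp
qed

lemma hnorm_Kp: "hnorm H (Kw p) = 1"
  using ip_Kw[OF p Kw_in[OF p]] H.ip_self[OF Kw_in[OF p]] H.hnorm_nonneg[OF Kw_in[OF p]] p
  by (simp add: H.kern_def scaleC_complex_def kernel_p) (simp add: power2_eq_1_iff flip: of_real_power)

text \<open>The representing vectors \<open>tens (Kw p) u\<close> have the norm of \<open>u\<close>,
  so evaluation at \<open>p\<close> is a contraction.\<close>

lemma bounded_op_eval: "bounded_op F E (\<lambda>f. f p)"
proof -
  have "hnorm E (f p) \<le> 1 * hnorm F f" if f: "f \<in> carr F" for f
  proof (rule E.hnorm_le_ip)
    fix u assume u: "u \<in> carr E"
    have "ip E (f p) u = ip F f (tens (Kw p) u)"
      using f u p by (simp add: tens_Kw ip_kern)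
    then have "cmod (ip E (f p) u) \<le> hnorm F f * hnorm E u"
      using Cauchy_Schwarz[OF f tens_in[OF Kw_in[OF p] u]] by (simp add: hnorm_tens[OF Kw_in[OF p] u] hnorm_Kp)
    then show "cmod (ip E u (f p)) \<le> 1 * hnorm F f * hnorm E u"
      using E.ip_cnj[OF value_in[OF f p] u] by simp
  qed (use f p value_in in auto)
  then show ?thesis
    unfolding bounded_op_def linear_op_def using p
    by (auto simp: value_in scaleC_fun_def intro!: exI[of _ 1])
qed

lemma bounded_op_tens_right: "bounded_op E F (tens (Kw p))"
proof -
  have "tens (Kw p) (x + y) = tens (Kw p) x + tens (Kw p) y" for x y :: 'e
    by (simp add: tens_def fun_eq_iff scaleC_add_right)
  then show ?thesis
    unfolding bounded_op_def linear_op_def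
    by (auto simp: tens_scaleC_right hnorm_tens Kw_in p intro!: exI[of _ 1] simp: hnorm_Kp)
qed

lemma conv_psum:
  assumes f: "f \<in> carr F"
  shows "conv (\<lambda>N. psum c F MF N f) (tens (Kw p) (f p))"
proof -
  have pw: "\<exists>M. \<forall>N. hnorm H (psum c H MH N h) \<le> M" if h: "h \<in> carr H" for h
  proof -
    obtain g where g: "H.conv (\<lambda>N. psum c H MH N h) g"
      using psum_convergent[OF h] by blast
    have "Bseq (\<lambda>N. hnorm H (psum c H MH N h))"
      using H.conv_hnorm[OF g] convergentI convergent_imp_Bseq by blast
    then obtain M where "\<And>N. norm (hnorm H (psum c H MH N h)) \<le> M"
      by (auto simp: Bseq_def)
    then have "\<forall>N. hnorm H (psum c H MH N h) \<le> M"
      using H.convD(1)[OF g] by simp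
    then show ?thesis ..
  qed
  obtain B where B: "0 \<le> B" "\<And>N h. h \<in> carr H \<Longrightarrow> hnorm H (psum c H MH N h) \<le> B * hnorm H h"
    using H.uniform_boundedness[OF HT.bounded_op_psum pw] by blast
  have bdF: "hnorm F (psum c F MF N f) \<le> B * hnorm F f" if f: "f \<in> carr F" for N f
  proof (rule hnorm_le_if_elementary_sums[OF FT.bounded_op_psum _ f])
    fix u assume "u \<in> elementary_sums"
    then obtain xs where xs: "xs \<in> lists (carr H \<times> carr E)" "u = elementary_sum xs"
      by (rule elementary_sums_mem)
    show "hnorm F (psum c F MF N u) \<le> B * hnorm F u"
      unfolding xs(2) psum_elementary_sum[OF xs(1)]
      by (rule hnorm_ampliation_le[OF HT.bounded_op_psum B xs(1)])
  qed
  have PF: "bounded_op F F (\<lambda>f. tens (Kw p) (f p))"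
    by (rule bounded_op_compose[OF bounded_op_eval bounded_op_tens_right inner_space_axioms
          E.inner_space_axioms])
  note P_add = bounded_op_add[OF PF] and P_scl = bounded_op_scaleC[OF PF]
  \<comment> \<open>Closedness of this set rests on the uniform bound \<open>bdF\<close> through
    \<open>conv_if_dense\<close>; it contains every \<open>kern w e\<close>, because tensoring with
    \<open>e\<close> carries \<open>conv_psum_Kw\<close> over to \<open>F\<close>.\<close>
  define N where "N = {f \<in> carr F. conv (\<lambda>n. psum c F MF n f) (tens (Kw p) (f p))}"
  have "N = carr F"
  proof (rule closed_subspace_eq_carr)
    show "csubspace N"
      unfolding csubspace_def
    proof (intro conjI ballI allI)
      have "psum c F MF n 0 = 0" "tens (Kw p) ((0::'z \<Rightarrow> 'e) p) = 0" for n
        using linear_op_zero[of F F "psum c F MF n"] FT.bounded_op_psum linear_op_zero[of F F] PF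
          inner_space_axioms unfolding bounded_op_def by blast+
      then show "0 \<in> N"
        using conv_const[OF zero_in] unfolding N_def by simp
      fix f assume "f \<in> N"
      then have f: "f \<in> carr F" "conv (\<lambda>n. psum c F MF n f) (tens (Kw p) (f p))"
        by (auto simp: N_def)
      show "f + g \<in> N" if "g \<in> N" for g
      proof -
        have g: "g \<in> carr F" "conv (\<lambda>n. psum c F MF n g) (tens (Kw p) (g p))"
          using that by (auto simp: N_def)
        show ?thesis
          using conv_add[OF f(2) g(2)] add_in[OF f(1) g(1)] P_add[OF f(1) g(1)]
          by (simp add: N_def bounded_op_add[OF FT.bounded_op_psum f(1) g(1)] del: plus_fun_apply)
      qed
      show "t *\<^sub>C f \<in> N" for t
        using conv_scaleC[OF f(2), of t] scaleC_in[OF f(1)] P_scl[OF f(1), of t]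
        by (simp add: N_def bounded_op_scaleC[OF FT.bounded_op_psum f(1)])
    qed
    show "N \<subseteq> carr F"
      by (auto simp: N_def)
    have kN: "kern w e \<in> N" if w: "w \<in> X" and e: "e \<in> carr E" for w e
    proof -
      have "kern w e p = e"
        using w p by (simp add: kern_def kernel_p scaleC_one)
      then show ?thesis
        using bounded_op_conv[OF bounded_op_tens[OF e] H.inner_space_axioms inner_space_axioms
            conv_psum_Kw[OF w]] kern_in[OF w e] psum_tens[OF Kw_in[OF w] e]
        by (simp add: N_def tens_Kw)
    qed
    show "x = 0" if x: "x \<in> carr F" and o: "\<And>u. u \<in> N \<Longrightarrow> ip F u x = 0" for x
    proof (rule eqI_kern[OF x zero_in])
      show "ip F x (kern w e) = ip F 0 (kern w e)" if "w \<in> X" "e \<in> carr E" for w e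
        using o[OF kN[OF that]] ip_cnj[OF kern_in[OF that] x] ip_zero_left[OF kern_in[OF that]] by simp
    qed
    show "x \<in> N" if s: "\<And>n. s n \<in> N" and cx: "conv s x" for s x
      using conv_if_dense[OF FT.bounded_op_psum bdF B(1) PF convD(1)[OF cx] cx] s convD(2)[OF cx]
      by (auto simp: N_def)
  qed
  then show ?thesis
    using f by (auto simp: N_def)
qed

text \<open>This is the form of sigma^n(P) with P the projection onto the constants: f(p) times the
  conjugate of g(p) is <P f, g>, and the recursion is that of
  \<open>ip_sigma_power_Suc\<close>.\<close>

primrec eval_form :: "nat \<Rightarrow> ('z \<Rightarrow> complex) \<Rightarrow> ('z \<Rightarrow> complex) \<Rightarrow> complex" where
  "eval_form 0 f g = f p * cnj (g p)"
| "eval_form (Suc n) f g = (\<Sum>i\<in>UNIV. eval_form n (adj H H (MH i) f) (adj H H (MH i) g))"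

lemma eval_form_add_left:
  "f \<in> carr H \<Longrightarrow> f' \<in> carr H \<Longrightarrow> eval_form n (f + f') g = eval_form n f g + eval_form n f' g"
  by (induction n arbitrary: f f' g)
    (simp_all add: distrib_right bounded_op_add[OF HT.Tadj] sum.distrib)

lemma eval_form_scaleC_left: "f \<in> carr H \<Longrightarrow> eval_form n (t *\<^sub>C f) g = t * eval_form n f g"
proof (induction n arbitrary: f g)
  case 0
  then show ?case
    by (simp add: scaleC_fun_def scaleC_complex_def)
next
  case (Suc n)
  then show ?case
    by (simp add: bounded_op_scaleC[OF HT.Tadj] sum_distrib_left)
qed

lemma eval_form_cnj: "eval_form n g f = cnj (eval_form n f g)"
proof (induction n arbitrary: f g)
  case (Suc n)
  show ?case
    unfolding eval_form.simps cnj_sum by (intro sum.cong refl Suc.IH)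
qed (simp add: mult.commute)

lemma eval_form_pos: "0 \<le> Re (eval_form n f f)"
  by (induction n arbitrary: f) (auto intro: sum_nonneg)

lemma eval_form_conv: "H.conv s f \<Longrightarrow> (\<lambda>k. eval_form n (s k) (s k)) \<longlonglongrightarrow> eval_form n f f"
proof (induction n arbitrary: s f)
  case 0
  then show ?case
    using H.conv_value[of s f 1 p] by (auto intro!: tendsto_mult tendsto_cnj)
next
  case (Suc n)
  then show ?case
    using bounded_op_conv[OF HT.Tadj H.inner_space_axioms H.inner_space_axioms Suc.prems]
    by (auto intro!: tendsto_sum)
qed

text \<open>Kernel functions take the value 1 at \<open>p\<close>, and each recursion step
  contributes a pair of eigenvalues. Weighted with the \<open>a n\<close>, these powers sum to the
  kernel, which is <Kw w, Kw z>.\<close>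

lemma eval_form_Kw:
  assumes "w \<in> X" "z \<in> X"
  shows "eval_form n (Kw w) (Kw z) = (\<Sum>i\<in>UNIV. m i z * cnj (m i w)) ^ n"
proof (induction n)
  case 0
  show ?case
    using assms p by (simp add: H.kern_def kernel_p scaleC_complex_def)
next
  case (Suc n)
  have K: "Kw w \<in> carr H" "Kw z \<in> carr H"
    using assms by (simp_all add: Kw_in)
  have swap: "eval_form n (Kw z) (Kw w) = cnj ((\<Sum>i\<in>UNIV. m i z * cnj (m i w)) ^ n)"
    by (simp only: eval_form_cnj[of n "Kw z" "Kw w"] Suc)
  have "eval_form n (adj H H (MH i) (Kw w)) (adj H H (MH i) (Kw z))
    = (m i z * cnj (m i w)) * (\<Sum>i\<in>UNIV. m i z * cnj (m i w)) ^ n" for i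
    unfolding adj_mul_Kw[OF mul_bounded assms(1)] adj_mul_Kw[OF mul_bounded assms(2)]
      eval_form_scaleC_left[OF K(1)] eval_form_cnj[of n _ "cnj (m i z) *\<^sub>C Kw z"]
      eval_form_scaleC_left[OF K(2)]
    by (simp add: swap)
  then show ?case
    by (simp add: sum_distrib_right[symmetric])
qed

text \<open>The form sees its arguments only through the values at \<open>p\<close> of words in the
  adjoints.\<close>

lemma eval_form_diff_null:
  assumes "f \<in> carr H" "h \<in> carr H" "\<And>I. adj_word H MH I h p = 0"
  shows "eval_form n (f - h) (f - h) = eval_form n f f"
  using assms
proof (induction n arbitrary: f h)
  case 0
  then show ?case
    using "0.prems"(3)[of "[]"] by simp
next
  case (Suc n)
  have "eval_form n (adj H H (MH i) (f - h)) (adj H H (MH i) (f - h))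
    = eval_form n (adj H H (MH i) f) (adj H H (MH i) f)" for i
    unfolding bounded_op_diff[OF HT.Tadj H.inner_space_axioms Suc.prems(1,2)]
    using Suc.prems(3)[of "i # _"] by (intro Suc.IH) (simp_all add: Suc.prems)
  then show ?case
    by (simp only: eval_form.simps)
qed

definition eval_psum :: "nat \<Rightarrow> ('z \<Rightarrow> complex) \<Rightarrow> ('z \<Rightarrow> complex) \<Rightarrow> complex" where
  "eval_psum N f g = (\<Sum>n<N. of_real (a n) * eval_form n f g)"

lemma eval_psum_add_left:
  "f \<in> carr H \<Longrightarrow> f' \<in> carr H \<Longrightarrow> eval_psum N (f + f') g = eval_psum N f g + eval_psum N f' g"
  by (simp add: eval_psum_def eval_form_add_left distrib_left sum.distrib)

lemma eval_psum_scaleC_left: "f \<in> carr H \<Longrightarrow> eval_psum N (t *\<^sub>C f) g = t * eval_psum N f g"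
  by (simp add: eval_psum_def eval_form_scaleC_left sum_distrib_left mult_ac)

lemma eval_psum_cnj: "eval_psum N g f = cnj (eval_psum N f g)"
  unfolding eval_psum_def cnj_sum complex_cnj_mult eval_form_cnj[of _ g f, symmetric]
  by (simp only: complex_cnj_complex_of_real)

text \<open>The vectors on which the a-series resolves the identity when tested against
  \<open>G\<close>. With \<open>G\<close> as a parameter, convergence can be extended in one
  argument at a time.\<close>

definition resolved :: "('z \<Rightarrow> complex) set \<Rightarrow> ('z \<Rightarrow> complex) set" where
  "resolved G = {f \<in> carr H. \<forall>g\<in>G. (\<lambda>N. eval_psum N f g) \<longlonglongrightarrow> ip H f g}"

lemma resolved_csubspace:
  assumes G: "G \<subseteq> carr H"
  shows "csubspace (resolved G)"
  unfolding csubspace_def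
proof (intro conjI ballI allI)
  have "eval_psum N 0 g = 0" for N g
    using eval_psum_scaleC_left[OF H.zero_in, of N 0 g] by simp
  then show "0 \<in> resolved G"
    using G by (auto simp: resolved_def subset_iff)
  fix f assume "f \<in> resolved G"
  then have f: "f \<in> carr H" "\<And>g. g \<in> G \<Longrightarrow> (\<lambda>N. eval_psum N f g) \<longlonglongrightarrow> ip H f g"
    by (auto simp: resolved_def)
  have G': "g \<in> carr H" if "g \<in> G" for g
    using that G by blast
  show "f + f' \<in> resolved G" if "f' \<in> resolved G" for f'
    using that f G' unfolding resolved_def
    by (auto simp del: plus_fun_apply simp: eval_psum_add_left H.ip_add_left intro!: tendsto_add)
  show "t *\<^sub>C f \<in> resolved G" for t
    using f G' unfolding resolved_def
    by (auto simp: eval_psum_scaleC_left H.ip_scaleC_left intro!: tendsto_mult_left)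
qed

text \<open>The identity \<open>\<Sum>n. a n \<sigma>\<^sup>n(P) = 1\<close>, where \<open>P\<close> is the projection onto the constants, holds
  weakly on kernel functions. Positivity of the coefficients bounds the partial sums by 1, so a
  function on which all summands vanish can be approximated only by 0.\<close>

lemma eq_zero_if_adj_words_vanish:
  assumes h: "h \<in> carr H" and null: "\<And>I. adj_word H MH I h p = 0"
  shows "h = 0"
proof -
  \<comment> \<open>\<open>D1\<close> extends the left argument beyond the kernel functions; by
    hermitian symmetry the kernel functions lie in \<open>resolved D1\<close>. So \<open>D\<close>
    is a subspace containing them on which both arguments may vary, in particular on the diagonal,
    and no finite linear combinations need to be written out.\<close>
  define D1 where "D1 = resolved (Kw ` X)"
  define D where "D = resolved D1 \<inter> D1"
  have K1: "Kw ` X \<subseteq> D1"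
    unfolding D1_def resolved_def
    using a_sums by (auto simp: Kw_in ip_Kw sums_def eval_psum_def eval_form_Kw)
      (simp add: H.kern_def scaleC_complex_def)
  have D1H: "D1 \<subseteq> carr H"
    by (auto simp: D1_def resolved_def)
  have "Kw ` X \<subseteq> resolved D1"
  proof
    fix g assume g: "g \<in> Kw ` X"
    have gH: "g \<in> carr H"
      using g Kw_in by blast
    have "(\<lambda>N. eval_psum N g f) \<longlonglongrightarrow> ip H g f" if f: "f \<in> D1" for f
    proof -
      have fH: "f \<in> carr H"
        using f D1H by blast
      have "(\<lambda>N. cnj (eval_psum N f g)) \<longlonglongrightarrow> cnj (ip H f g)"
        using f g unfolding D1_def resolved_def by (intro tendsto_cnj) blast
      then show ?thesis
        by (simp only: eval_psum_cnj[of _ g f] H.ip_cnj[OF fH gH])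
    qed
    then show "g \<in> resolved D1"
      using gH by (simp add: resolved_def)
  qed
  then have KD: "Kw ` X \<subseteq> D"
    using K1 by (simp add: D_def)
  have DH: "D \<subseteq> carr H"
    using D1H by (auto simp: D_def)
  have D_sub: "csubspace D"
    using resolved_csubspace[OF D1H] resolved_csubspace[of "Kw ` X"] Kw_in
    unfolding D_def D1_def csubspace_def by blast
  have lim: "(\<lambda>N. Re (eval_psum N f f)) \<longlonglongrightarrow> (hnorm H f)\<^sup>2" if "f \<in> D" for f
    using that DH H.hnorm_sq[of f] unfolding D_def resolved_def by (auto intro!: tendsto_Re)
  have mono: "incseq (\<lambda>N. Re (eval_psum N f f))" for f
    by (rule incseq_SucI) (simp add: eval_psum_def a_nonneg eval_form_pos)
  have approx: "\<exists>s. (\<forall>n. s n \<in> D) \<and> H.conv s f" if f: "f \<in> carr H" for f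
  proof -
    have "x = 0" if x: "x \<in> carr H" and o: "\<And>u. u \<in> D \<Longrightarrow> ip H u x = 0" for x
    proof (rule eqI_Kw[OF x H.zero_in])
      show "ip H x (Kw w) = ip H 0 (Kw w)" if w: "w \<in> X" for w
        using o[of "Kw w"] KD w H.ip_cnj[OF Kw_in[OF w] x] H.ip_zero_left[OF Kw_in[OF w]] by auto
    qed
    from H.dense_if_ortho_trivial[OF D_sub DH this f] show ?thesis
      by metis
  qed
  \<comment> \<open>On \<open>D\<close> a monotone sequence lies below its limit; continuity of each
    partial sum extends this to \<open>H\<close>. The extension matters because the bound is applied
    to \<open>s k - h\<close>, which need not lie in \<open>D\<close>.\<close>
  have le: "Re (eval_psum N f f) \<le> (hnorm H f)\<^sup>2" if f: "f \<in> carr H" for N f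
  proof -
    obtain s where s: "\<And>n. s n \<in> D" "H.conv s f"
      using approx[OF f] by blast
    have leD: "Re (eval_psum N (s k) (s k)) \<le> (hnorm H (s k))\<^sup>2" for k
      by (rule incseq_le[OF mono lim[OF s(1)]])
    have "(\<lambda>k. Re (eval_psum N (s k) (s k))) \<longlonglongrightarrow> Re (eval_psum N f f)"
      unfolding eval_psum_def
      by (intro tendsto_Re tendsto_sum tendsto_mult_left eval_form_conv s(2))
    then show ?thesis
      using leD by (intro LIMSEQ_le[OF _ tendsto_power[OF H.conv_hnorm[OF s(2)]]]) blast+
  qed
  obtain s where s: "\<And>n. s n \<in> D" "H.conv s h"
    using approx[OF h] by blast
  have sH: "s k \<in> carr H" for k
    using s(1) DH by blast
  \<comment> \<open>The vectors \<open>s k\<close> and \<open>s k - h\<close> have the same partial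
    sums. For \<open>s k\<close> these tend to its squared norm, and for \<open>s k - h\<close> they
    are bounded by its squared norm, which tends to 0.\<close>
  have "(hnorm H (s k))\<^sup>2 \<le> (hnorm H (s k - h))\<^sup>2" for k
  proof (rule LIMSEQ_le_const2[OF lim[OF s(1)]])
    have "Re (eval_psum N (s k) (s k)) \<le> (hnorm H (s k - h))\<^sup>2" for N
      using le[OF H.diff_in[OF sH h], of N k] by (simp only: eval_psum_def eval_form_diff_null[OF sH h null])
    then show "\<exists>N. \<forall>n\<ge>N. Re (eval_psum n (s k) (s k)) \<le> (hnorm H (s k - h))\<^sup>2"
      by blast
  qed
  then have "(hnorm H h)\<^sup>2 \<le> 0\<^sup>2"
    by (intro LIMSEQ_le[OF tendsto_power[OF H.conv_hnorm[OF s(2)]] tendsto_power[OF H.convD(3)[OF s(2)]]]) blast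
  then show ?thesis
    using H.hnorm_eq_0[OF h] by simp
qed

end

section \<open>Dilations\<close>

text \<open>Polarisation: expanding the norm of a sum gives the real parts, and replacing
  \<open>x\<close> by i times \<open>x\<close> the imaginary ones.\<close>

lemma isometric_ip:
  assumes j: "isometric_op V W j" and V: "inner_space V" and W: "inner_space W"
    and x: "x \<in> carr V" and y: "y \<in> carr V"
  shows "ip W (j x) (j y) = ip V x y"
proof -
  interpret V: inner_space V by fact
  interpret W: inner_space W by fact
  have j_in: "j u \<in> carr W" and j_add: "j (u + v) = j u + j v" and j_scl: "j (t *\<^sub>C u) = t *\<^sub>C j u"
    and j_norm: "hnorm W (j u) = hnorm V u" if "u \<in> carr V" "v \<in> carr V" for u v t
    using j that by (auto simp: isometric_op_def linear_op_def)
  have Re: "Re (ip W (j u) (j y)) = Re (ip V u y)" if u: "u \<in> carr V" for u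
    using V.hnorm_add_sq[OF u y] W.hnorm_add_sq[OF j_in[OF u u] j_in[OF y y]]
      j_norm[OF V.add_in[OF u y] y] j_norm[OF u y] j_norm[OF y y] j_add[OF u y] by simp
  show ?thesis
  proof (rule complex_eqI_Re_ii)
    show "Re (\<i> * ip W (j x) (j y)) = Re (\<i> * ip V x y)"
      using Re[OF V.scaleC_in[OF x, of \<i>]]
      by (simp only: j_scl[OF x x] W.ip_scaleC_left[OF j_in[OF x x] j_in[OF y y]] V.ip_scaleC_left[OF x y])
  qed (rule Re[OF x])
qed

text \<open>Constructs the value at \<open>e\<close> of the operator taking \<open>g1 x\<close> to
  \<open>g2 x\<close> by duality instead of extension by continuity: Riesz represents the functional
  taking \<open>g2 x\<close> to \<open>ip E1 (g1 x) e\<close>.\<close>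

lemma representing_contraction:
  fixes g1 :: "'x \<Rightarrow> 'a::complex_vector" and g2 :: "'x \<Rightarrow> 'b::complex_vector"
  assumes E1: "inner_space E1" and E2: "hilb E2"
    and g1: "\<And>x. x \<in> D \<Longrightarrow> g1 x \<in> carr E1" and g2: "\<And>x. x \<in> D \<Longrightarrow> g2 x \<in> carr E2"
    and ip_eq: "\<And>x y. x \<in> D \<Longrightarrow> y \<in> D \<Longrightarrow> ip E1 (g1 x) (g1 y) = ip E2 (g2 x) (g2 y)"
    and sub: "csubspace (g2 ` D)" and e: "e \<in> carr E1"
  shows "\<exists>e'\<in>carr E2. (\<forall>x\<in>D. ip E2 (g2 x) e' = ip E1 (g1 x) e) \<and> hnorm E2 e' \<le> hnorm E1 e"
proof -
  interpret E1: inner_space E1 by fact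
  interpret E2: hilb E2 by fact
  \<comment> \<open>A choice of preimages; by \<open>lin\<close> the functional
    \<open>\<phi>\<close> does not depend on it.\<close>
  define r where "r u = (SOME x. x \<in> D \<and> g2 x = u)" for u
  define \<phi> where "\<phi> u = ip E1 (g1 (r u)) e" for u
  have r: "r u \<in> D \<and> g2 (r u) = u" if "u \<in> g2 ` D" for u
    unfolding r_def using that by (intro someI_ex[of "\<lambda>x. x \<in> D \<and> g2 x = u"]) blast
  have norm_eq: "hnorm E1 (g1 x) = hnorm E2 (g2 x)" if "x \<in> D" for x
    using ip_eq[OF that that] by (simp add: hnorm_def)
  \<comment> \<open>The Gram matrices agree, so a linear relation among values of \<open>g2\<close>
    makes the corresponding vector in \<open>E1\<close> have norm 0.\<close>
  have lin: "g1 x = s *\<^sub>C g1 y + t *\<^sub>C g1 z"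
    if D: "x \<in> D" "y \<in> D" "z \<in> D" and eq: "g2 x = s *\<^sub>C g2 y + t *\<^sub>C g2 z" for x y z s t
  proof -
    define d where "d = g1 x - (s *\<^sub>C g1 y + t *\<^sub>C g1 z)"
    have "ip E1 d d = ip E2 (g2 x - (s *\<^sub>C g2 y + t *\<^sub>C g2 z)) (g2 x - (s *\<^sub>C g2 y + t *\<^sub>C g2 z))"
      unfolding d_def using D g1 g2
      by (simp add: E1.ip_diff_left E1.ip_diff_right E2.ip_diff_left E2.ip_diff_right
          E1.ip_add_left E1.ip_add_right E2.ip_add_left E2.ip_add_right
          E1.ip_scaleC_left E1.ip_scaleC_right E2.ip_scaleC_left E2.ip_scaleC_right ip_eq)
    then have "ip E1 d d = 0"
      by (simp add: eq)
    then have "d = 0"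
      using D g1 by (intro E1.ip_definite) (simp_all add: d_def)
    then show ?thesis
      by (simp add: d_def)
  qed
  have sub_add: "u + v \<in> g2 ` D" and sub_scl: "t *\<^sub>C u \<in> g2 ` D"
    if "u \<in> g2 ` D" "v \<in> g2 ` D" for u v t
    using sub that unfolding csubspace_def by blast+
  obtain e' s where e': "e' \<in> carr E2" "\<And>u. u \<in> g2 ` D \<Longrightarrow> ip E2 u e' = \<phi> u"
    and s: "\<And>n. s n \<in> g2 ` D" "E2.conv s e'"
  proof (rule E2.Riesz_on_subspace[OF sub, of \<phi> "hnorm E1 e"])
    show "g2 ` D \<subseteq> carr E2"
      using g2 by blast
    show "\<phi> (u + v) = \<phi> u + \<phi> v" if u: "u \<in> g2 ` D" and v: "v \<in> g2 ` D" for u v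
      using lin[of "r (u + v)" "r u" "r v" 1 1] r[OF sub_add[OF u v, of]] r[OF u] r[OF v] g1 e
      by (simp add: \<phi>_def scaleC_one E1.ip_add_left)
    show "\<phi> (t *\<^sub>C u) = t * \<phi> u" if u: "u \<in> g2 ` D" for t u
      using lin[of "r (t *\<^sub>C u)" "r u" "r u" t 0] r[OF sub_scl[OF u u]] r[OF u] g1 e
      by (simp add: \<phi>_def E1.ip_scaleC_left)
    show "cmod (\<phi> u) \<le> hnorm E1 e * hnorm E2 u" if u: "u \<in> g2 ` D" for u
      using E1.Cauchy_Schwarz[OF g1 e, of "r u"] r[OF u] norm_eq[of "r u"]
      by (simp add: \<phi>_def mult.commute)
  qed blast
  have ip_e': "ip E2 (g2 x) e' = ip E1 (g1 x) e" if x: "x \<in> D" for x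
  proof -
    have u: "g2 x \<in> g2 ` D"
      using x by blast
    have "g1 (r (g2 x)) = g1 x"
      using lin[of "r (g2 x)" x x 1 0] r[OF u] x by (simp add: scaleC_one)
    then show ?thesis
      using e'(2)[OF u] by (simp add: \<phi>_def)
  qed
  \<comment> \<open>Only vectors of the form \<open>g2 x\<close> can be compared with
    \<open>e\<close>; the inequality for \<open>e'\<close> arises in the limit along
    \<open>s\<close>.\<close>
  have "hnorm E2 e' * hnorm E2 e' \<le> hnorm E2 e' * hnorm E1 e"
  proof (rule LIMSEQ_le)
    show "(\<lambda>n. cmod (ip E2 (s n) e')) \<longlonglongrightarrow> hnorm E2 e' * hnorm E2 e'"
      using tendsto_norm[OF E2.conv_ip_left[OF s(2) e'(1)]]
      unfolding E2.ip_self[OF e'(1)] by (simp add: power2_eq_square norm_mult e')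
    show "(\<lambda>n. hnorm E2 (s n) * hnorm E1 e) \<longlonglongrightarrow> hnorm E2 e' * hnorm E1 e"
      by (rule tendsto_mult_right[OF E2.conv_hnorm[OF s(2)]])
    have "cmod (ip E2 u e') \<le> hnorm E2 u * hnorm E1 e" if "u \<in> g2 ` D" for u
      using that ip_e' E1.Cauchy_Schwarz[OF g1 e] norm_eq by fastforce
    then show "\<exists>N. \<forall>n\<ge>N. cmod (ip E2 (s n) e') \<le> hnorm E2 (s n) * hnorm E1 e"
      using s(1) by blast
  qed
  then have "hnorm E2 e' \<le> hnorm E1 e"
    using E2.hnorm_nonneg[OF e'(1)] E1.hnorm_nonneg[OF e] by (cases "hnorm E2 e' = 0") auto
  then show ?thesis
    using e' ip_e' by blast
qed

text \<open>The contractions obtained in the two directions are mutually inverse, hence isometric.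
  Linearity and the inverse laws are checked by pairing with the total families.\<close>

lemma unitary_between_total_families:
  fixes g1 :: "'x \<Rightarrow> 'a::complex_vector" and g2 :: "'x \<Rightarrow> 'b::complex_vector"
  assumes E1: "hilb E1" and E2: "hilb E2"
    and g1: "\<And>x. x \<in> D \<Longrightarrow> g1 x \<in> carr E1" and g2: "\<And>x. x \<in> D \<Longrightarrow> g2 x \<in> carr E2"
    and ip_eq: "\<And>x y. x \<in> D \<Longrightarrow> y \<in> D \<Longrightarrow> ip E1 (g1 x) (g1 y) = ip E2 (g2 x) (g2 y)"
    and sub1: "csubspace (g1 ` D)" and sub2: "csubspace (g2 ` D)"
    and total1: "\<And>e. e \<in> carr E1 \<Longrightarrow> (\<And>x. x \<in> D \<Longrightarrow> ip E1 (g1 x) e = 0) \<Longrightarrow> e = 0"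
    and total2: "\<And>e. e \<in> carr E2 \<Longrightarrow> (\<And>x. x \<in> D \<Longrightarrow> ip E2 (g2 x) e = 0) \<Longrightarrow> e = 0"
  obtains U where "unitary_op E1 E2 U" "\<And>x. x \<in> D \<Longrightarrow> U (g1 x) = g2 x"
proof -
  interpret E1: hilb E1 by fact
  interpret E2: hilb E2 by fact
  obtain U where U: "\<And>e. e \<in> carr E1 \<Longrightarrow> U e \<in> carr E2"
      "\<And>e x. e \<in> carr E1 \<Longrightarrow> x \<in> D \<Longrightarrow> ip E2 (g2 x) (U e) = ip E1 (g1 x) e"
      "\<And>e. e \<in> carr E1 \<Longrightarrow> hnorm E2 (U e) \<le> hnorm E1 e"
    using representing_contraction[OF E1.inner_space_axioms E2 g1 g2 ip_eq sub2] by metis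
  obtain W where W: "\<And>e. e \<in> carr E2 \<Longrightarrow> W e \<in> carr E1"
      "\<And>e x. e \<in> carr E2 \<Longrightarrow> x \<in> D \<Longrightarrow> ip E1 (g1 x) (W e) = ip E2 (g2 x) e"
      "\<And>e. e \<in> carr E2 \<Longrightarrow> hnorm E1 (W e) \<le> hnorm E2 e"
    using representing_contraction[OF E2.inner_space_axioms E1 g2 g1 ip_eq[symmetric] sub1] by metis
  have eq1: "e = f" if "e \<in> carr E1" "f \<in> carr E1" "\<And>x. x \<in> D \<Longrightarrow> ip E1 (g1 x) e = ip E1 (g1 x) f" for e f
    using total1[of "e - f"] that g1 by (simp add: E1.ip_diff_right)
  have eq2: "e = f" if "e \<in> carr E2" "f \<in> carr E2" "\<And>x. x \<in> D \<Longrightarrow> ip E2 (g2 x) e = ip E2 (g2 x) f" for e f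
    using total2[of "e - f"] that g2 by (simp add: E2.ip_diff_right)
  have WU: "W (U e) = e" if "e \<in> carr E1" for e
    using that U W by (intro eq1) simp_all
  have UW: "U (W e) = e" if "e \<in> carr E2" for e
    using that U W by (intro eq2) simp_all
  have add: "U (e + f) = U e + U f" if "e \<in> carr E1" "f \<in> carr E1" for e f
    using that U(1,2) g1 g2 by (intro eq2) (simp_all add: E1.ip_add_right E2.ip_add_right)
  have scl: "U (t *\<^sub>C e) = t *\<^sub>C U e" if "e \<in> carr E1" for t e
    using that U(1,2) g1 g2 by (intro eq2) (simp_all add: E1.ip_scaleC_right E2.ip_scaleC_right)
  have norm: "hnorm E2 (U e) = hnorm E1 e" if "e \<in> carr E1" for e
    using U(3)[OF that] W(3)[OF U(1)[OF that]] WU[OF that] by simp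
  have "carr E2 \<subseteq> U ` carr E1"
    using UW W(1) by (metis image_eqI subsetI)
  then have "unitary_op E1 E2 U"
    using U(1) add scl norm by (auto simp: unitary_op_def isometric_op_def linear_op_def)
  moreover have "U (g1 x) = g2 x" if "x \<in> D" for x
    using that U(1,2) g1 g2 ip_eq by (intro eq2) simp_all
  ultimately show ?thesis
    using that by blast
qed

lemma (in op_tuple) adj_word_diff:
  "x \<in> carr V \<Longrightarrow> y \<in> carr V \<Longrightarrow> adj_word V T I (x - y) = adj_word V T I x - adj_word V T I y"
  by (induction I arbitrary: x y) (simp_all add: bounded_op_diff[OF Tadj inner])

section \<open>Evaluation of a dilation at the base point\<close>

locale dilation = unital_kernel X \<kappa> H E F m p a c + D: op_tuple D T
  for X :: "'z set" and \<kappa> :: "'z \<Rightarrow> 'z \<Rightarrow> complex" and H :: "('z \<Rightarrow> complex) hspace"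
    and E :: "'e::complex_vector hspace" and F :: "('z \<Rightarrow> 'e) hspace" and m :: "'d::finite \<Rightarrow> 'z \<Rightarrow> complex"
    and p a c and D :: "'h::complex_vector hspace" and T :: "'d \<Rightarrow> 'h \<Rightarrow> 'h" +
  fixes j :: "'h \<Rightarrow> 'z \<Rightarrow> 'e"
  assumes isometric: "isometric_op D F j"
    and intertwine: "x \<in> carr D \<Longrightarrow> j (adj D D (T i) x) = adj F F (MF i) (j x)"
begin

lemma j_in [simp]: "x \<in> carr D \<Longrightarrow> j x \<in> carr F"
  and j_add: "x \<in> carr D \<Longrightarrow> y \<in> carr D \<Longrightarrow> j (x + y) = j x + j y"
  and j_scaleC: "x \<in> carr D \<Longrightarrow> j (t *\<^sub>C x) = t *\<^sub>C j x"
  using isometric by (auto simp: isometric_op_def linear_op_def)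

lemma ip_sigma_power_j:
  "x \<in> carr D \<Longrightarrow> y \<in> carr D \<Longrightarrow>
    ip F ((sigma F MF ^^ n) (\<lambda>y. y) (j x)) (j y) = ip D ((sigma D T ^^ n) (\<lambda>y. y) x) y"
proof (induction n arbitrary: x y)
  case 0
  then show ?case
    using isometric_ip[OF isometric D.inner inner_space_axioms] by simp
next
  case (Suc n)
  show ?case
    unfolding FT.ip_sigma_power_Suc[OF j_in[OF Suc.prems(1)] j_in[OF Suc.prems(2)]]
      D.ip_sigma_power_Suc[OF Suc.prems] intertwine[OF Suc.prems(1), symmetric]
      intertwine[OF Suc.prems(2), symmetric]
    by (intro sum.cong refl Suc.IH D.Tadj_in Suc.prems)
qed

lemma ip_psum_j:
  assumes "x \<in> carr D" "y \<in> carr D"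
  shows "ip F (psum c F MF N (j x)) (j y) = ip D (psum c D T N x) y"
  unfolding psum_def
  by (simp add: assms ip_sum_left D.ip_sum_left ip_scaleC_left D.ip_scaleC_left ip_sigma_power_j)

text \<open>Compressing the partial sums for multiplication by \<open>j\<close> gives those for
  \<open>T\<close>. By \<open>conv_psum\<close> they tend to the compressed projection onto the
  constants, whose form is the right-hand side; the left-hand side no longer mentions
  \<open>j\<close>.\<close>

lemma ip_j_p:
  assumes x: "x \<in> carr D" and y: "y \<in> carr D"
  shows "(\<lambda>N. ip D (psum c D T N x) y) \<longlonglongrightarrow> ip E (j x p) (j y p)"
proof -
  have jp: "j x p \<in> carr E" "j y p \<in> carr E"
    using x y p by (auto intro: value_in)
  have "ip F (tens (Kw p) (j x p)) (j y) = cnj (ip F (j y) (kern p (j x p)))"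
    unfolding tens_Kw by (rule ip_cnj[OF j_in[OF y] kern_in[OF p jp(1)]])
  also have "\<dots> = ip E (j x p) (j y p)"
    unfolding ip_kern[OF p jp(1) j_in[OF y]] by (rule E.ip_cnj[OF jp(2,1), symmetric])
  finally show ?thesis
    using conv_ip_left[OF conv_psum[OF j_in[OF x]] j_in[OF y]] by (simp only: ip_psum_j[OF x y])
qed

lemma j_adj_word: "x \<in> carr D \<Longrightarrow> j (adj_word D T I x) = adj_word F MF I (j x)"
  by (induction I arbitrary: x) (simp_all add: intertwine)

text \<open>Intertwining moves the word from the slice to \<open>x\<close>. Together with
  \<open>eq_zero_if_adj_words_vanish\<close>, this shows that the values at \<open>p\<close>
  determine every slice.\<close>

lemma adj_word_slice_j:
  assumes "x \<in> carr D" "e \<in> carr E"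
  shows "adj_word H MH I (slice E (j x) e) p = ip E (j (adj_word D T I x) p) e"
  by (simp add: slice_adj_word[symmetric] assms j_adj_word) (simp add: slice_def)

lemma csubspace_range_p: "csubspace ((\<lambda>x. j x p) ` carr D)"
  unfolding csubspace_def
proof (intro conjI ballI allI)
  have j0: "j 0 = 0"
    using j_scaleC[OF D.zero_in, of 0] by simp
  then show "0 \<in> (\<lambda>x. j x p) ` carr D"
    by (intro image_eqI[of _ _ 0]) simp_all
  fix u assume "u \<in> (\<lambda>x. j x p) ` carr D"
  then obtain x where x: "x \<in> carr D" "u = j x p"
    by blast
  show "u + v \<in> (\<lambda>x. j x p) ` carr D" if v: "v \<in> (\<lambda>x. j x p) ` carr D" for v
  proof -
    obtain y where y: "y \<in> carr D" "v = j y p"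
      using v by blast
    show ?thesis
      by (rule image_eqI[of _ _ "x + y"]) (simp_all add: x y j_add)
  qed
  show "t *\<^sub>C u \<in> (\<lambda>x. j x p) ` carr D" for t
    by (rule image_eqI[of _ _ "t *\<^sub>C x"]) (simp_all add: x j_scaleC scaleC_fun_def)
qed

lemma range_p_total_if_minimal:
  assumes minimal: "\<And>M. closed_subspace F M \<Longrightarrow> reducing F MF M \<Longrightarrow> j ` carr D \<subseteq> M \<Longrightarrow> M = carr F"
    and e: "e \<in> carr E" and o: "\<And>x. x \<in> carr D \<Longrightarrow> ip E (j x p) e = 0"
  shows "e = 0"
proof -
  define M where "M = {f \<in> carr F. slice E f e = 0}"
  have slice_add: "slice E (f + g) e = slice E f e + slice E g e"
    and slice_scaleC: "slice E (t *\<^sub>C f) e = t *\<^sub>C slice E f e" if "f \<in> carr F" "g \<in> carr F" for f g t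
    using that e by (simp_all add: slice_def fun_eq_iff E.ip_add_left E.ip_scaleC_left value_in'
        scaleC_fun_def scaleC_complex_def)
  have "closed_subspace F M"
  proof (rule closed_subspaceI)
    show "csubspace M"
      unfolding csubspace_def
    proof (intro conjI ballI allI)
      have "slice E (0::'z \<Rightarrow> 'e) e = 0"
        using slice_scaleC[OF zero_in zero_in, of 0] by simp
      then show "0 \<in> M"
        by (simp add: M_def)
      fix f assume "f \<in> M"
      then have f: "f \<in> carr F" "slice E f e = 0"
        by (auto simp: M_def)
      show "f + g \<in> M" if "g \<in> M" for g
        using that f add_in[of f g] slice_add[of f g] unfolding M_def by simp
      show "t *\<^sub>C f \<in> M" for t
        using f slice_scaleC[OF f(1) f(1), of t] unfolding M_def by simp
    qed
    show "M \<subseteq> carr F"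
      by (auto simp: M_def)
    fix s f assume s: "\<And>n. s n \<in> M" and c: "conv s f"
    have "slice E f e z = 0" for z
    proof (rule LIMSEQ_unique[OF _ tendsto_const])
      have "ip E (s n z) e = 0" for n
        using s[of n] by (simp add: M_def slice_def fun_eq_iff)
      then show "(\<lambda>n. 0) \<longlonglongrightarrow> slice E f e z"
        using conv_value[OF c e, of z] by (simp add: slice_def)
    qed
    then show "f \<in> M"
      using convD(2)[OF c] by (simp add: M_def fun_eq_iff)
  qed
  moreover have "reducing F MF M"
    unfolding reducing_def
  proof (intro allI ballI conjI)
    fix i f assume "f \<in> M"
    then have f: "f \<in> carr F" "slice E f e = 0"
      by (auto simp: M_def)
    have "slice E (MF i f) e = 0"
      unfolding slice_mul[OF f(1) e] f(2) by (simp add: mul_def fun_eq_iff)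
    then show "MF i f \<in> M"
      using FT.T_in[OF f(1)] by (simp add: M_def)
    have "adj H H (MH i) 0 = 0"
      using HT.Tadj H.inner_space_axioms linear_op_zero unfolding bounded_op_def by blast
    then have "slice E (adj F F (MF i) f) e = 0"
      unfolding slice_adj_mul[OF mul_bounded f(1) e] f(2) .
    then show "adj F F (MF i) f \<in> M"
      using FT.Tadj_in[OF f(1)] by (simp add: M_def)
  qed
  moreover have "j ` carr D \<subseteq> M"
  proof
    fix f assume "f \<in> j ` carr D"
    then obtain x where x: "x \<in> carr D" "f = j x"
      by blast
    \<comment> \<open>All words of this slice vanish at \<open>p\<close>: by
      \<open>adj_word_slice_j\<close> they pair \<open>e\<close> with values \<open>j y p\<close>
      for \<open>y\<close> in \<open>carr D\<close>.\<close>
    have "slice E (j x) e = 0"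
      by (rule eq_zero_if_adj_words_vanish)
        (simp_all add: slice_in adj_word_slice_j o x e)
    then show "f \<in> M"
      using x by (simp add: M_def)
  qed
  ultimately have "M = carr F"
    by (rule minimal)
  \<comment> \<open>The constant function \<open>e\<close> on \<open>X\<close>; its slice against
    \<open>e\<close> has the value <e,e> at \<open>p\<close>.\<close>
  then have "kern p e \<in> M"
    using kern_in[OF p e] by simp
  then have "slice E (kern p e) e p = 0"
    by (simp add: M_def)
  then have "ip E e e = 0"
    using p by (simp add: slice_def kern_def kernel_p scaleC_one)
  then show ?thesis
    using e by (rule E.ip_definite[rotated])
qed

end

section \<open>The unit ball and the kernel k(<z,w>)\<close>

lemma cdot_in_ball:
  fixes z w :: "complex^'d"
  assumes "z \<in> ball 0 1" "w \<in> ball 0 1"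
  shows "cdot z w \<in> ball 0 1"
proof -
  have "cmod (cdot z w) \<le> (\<Sum>i\<in>UNIV. cmod (z $ i) * cmod (w $ i))"
    unfolding cdot_def using norm_sum[of "\<lambda>i. z $ i * cnj (w $ i)" UNIV] by (simp add: norm_mult)
  also have "\<dots> \<le> norm z * norm w"
    using L2_set_mult_ineq[of "\<lambda>i. cmod (z $ i)" "\<lambda>i. cmod (w $ i)" UNIV] by (simp add: norm_vec_def)
  also have "\<dots> < 1"
    using assms mult_strict_mono'[of "norm z" 1 "norm w" 1] by simp
  finally show ?thesis
    by simp
qed

lemma Mz_eq_mul: "(Mz :: 'd::finite \<Rightarrow> (complex^'d \<Rightarrow> 'e::complex_vector) \<Rightarrow> _) = (\<lambda>i. mul (\<lambda>z. z $ i))"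
  by (simp add: fun_eq_iff Mz_def mul_def)

lemma unital_kernel_HK:
  fixes HK :: "(complex^'d::finite \<Rightarrow> complex) hspace"
  assumes k: "kernel_function k a c" and HK: "is_HK k complex_hspace HK"
    and contr: "K_contraction c HK Mz" and E: "hilbert_space E" and F: "is_HK k E F"
  shows "unital_kernel (ball 0 1) (\<lambda>z w. k (cdot z w)) HK E F (\<lambda>i z. z $ i) 0 a c"
proof -
  have fE: "functional_hilbert_space (ball 0 1) (\<lambda>z w. k (cdot z w)) E F"
    and fH: "functional_hilbert_space (ball 0 1) (\<lambda>z w. k (cdot z w)) complex_hspace HK"
    using HK F by (auto simp: is_HK_def)
  have F': "hilb F" and H': "hilb HK"
    using fE fH by (auto simp: functional_hilbert_space_def intro: hilbI)
  interpret fhs_pair "ball 0 1" "\<lambda>z w. k (cdot z w)" HK E F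
    using F' H' hilbI[OF E] hilb_complex_hspace fE fH
    by (simp add: fhs_pair_def fhs_def fhs_axioms_def)
  have bd: "bounded_op HK HK (mul (\<lambda>z. z $ i))" for i :: 'd
    using contr by (simp add: K_contraction_def commuting_tuple_def Mz_eq_mul)
  interpret mult_tuple "ball 0 1" "\<lambda>z w. k (cdot z w)" HK E F "\<lambda>(i::'d) z. z $ i"
    by unfold_locales (rule bd)
  have k0: "k 0 = 1"
  proof -
    have "(0::complex) \<in> ball 0 1"
      by simp
    then have "(\<lambda>n. of_real (a n) * 0 ^ n) sums k 0" "a 0 = 1"
      using k unfolding kernel_function_def by blast+
    then show ?thesis
      using powser_sums_zero_iff[of "\<lambda>n. complex_of_real (a n)" "k 0"] by simp
  qed
  show ?thesis
  proof unfold_locales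
    show "0 \<in> ball (0::complex^'d) 1"
      by simp
    show "k (cdot 0 z) = 1" "k (cdot z 0) = 1" for z :: "complex^'d"
      by (simp_all add: cdot_def k0)
    show "0 \<le> a n" for n
      using k by (simp add: kernel_function_def less_imp_le)
    fix z w :: "complex^'d" assume zw: "z \<in> ball 0 1" "w \<in> ball 0 1"
    show "(\<lambda>n. of_real (a n) * (\<Sum>i\<in>UNIV. z $ i * cnj (w $ i)) ^ n) sums k (cdot z w)"
      using k cdot_in_ball[OF zw] unfolding kernel_function_def cdot_def[symmetric] by blast
    have "(\<lambda>n. c n * cdot z w ^ n) sums (1 / k (cdot z w))" "k (cdot z w) \<noteq> 0"
      using k cdot_in_ball[OF zw] unfolding kernel_function_def by blast+
    then show "(\<lambda>n. c n * ((\<Sum>i\<in>UNIV. z $ i * cnj (w $ i)) ^ n * k (cdot z w))) sums 1"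
      using sums_mult2[of "\<lambda>n. c n * cdot z w ^ n" "1 / k (cdot z w)" "k (cdot z w)"]
      by (simp add: cdot_def mult.assoc)
  next
    fix h assume h: "h \<in> carr HK"
    obtain P where "limitin H.mtopology (\<lambda>N. \<Sum>n<N. c n *\<^sub>C (sigma HK Mz ^^ n) (\<lambda>y. y) h) (P h) sequentially"
      using contr h unfolding K_contraction_def by blast
    then have "limitin H.mtopology (\<lambda>N. psum c HK (\<lambda>i. mul (\<lambda>z. z $ i)) N h) (P h) sequentially"
      by (simp add: psum_def Mz_eq_mul)
    then show "\<exists>g. H.conv (\<lambda>N. psum c HK (\<lambda>i. mul (\<lambda>z. z $ i)) N h) g"
      using H.conv_iff_limitin[of "\<lambda>N. psum c HK (\<lambda>i. mul (\<lambda>z. z $ i)) N h"]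
        bounded_op_in[OF HT.bounded_op_psum h] by blast
  qed
qed

theorem corollary4p3:
  fixes k :: "complex \<Rightarrow> complex" and a :: "nat \<Rightarrow> real" and c :: "nat \<Rightarrow> complex"
    and HK :: "(complex^'d \<Rightarrow> complex) hspace"
    and H :: "'h::complex_vector hspace"
    and E1 :: "'e1::complex_vector hspace" and E2 :: "'e2::complex_vector hspace"
    and HK1 :: "(complex^'d \<Rightarrow> 'e1) hspace" and HK2 :: "(complex^'d \<Rightarrow> 'e2) hspace"
    and T :: "'d::finite \<Rightarrow> 'h \<Rightarrow> 'h"
    and j1 :: "'h \<Rightarrow> complex^'d \<Rightarrow> 'e1" and j2 :: "'h \<Rightarrow> complex^'d \<Rightarrow> 'e2"
  assumes "kernel_function k a c"
    and "is_HK k complex_hspace HK"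
    and "essentially_normal HK Mz" and "K_contraction c HK Mz"
    and "hilbert_space H" and "hilbert_space E1" and "hilbert_space E2"
    and "is_HK k E1 HK1" and "is_HK k E2 HK2"
    and "commuting_tuple H T"
    and "minimal_K_dilation H T HK1 j1" and "minimal_K_dilation H T HK2 j2"
  shows "\<exists>U. unitary_op E1 E2 U \<and> (\<forall>x\<in>carr H. j2 x = id_tensor U (j1 x))"
proof -
  interpret D: op_tuple H T
    using assms(5,10) by (simp add: op_tuple_def op_tuple_axioms_def hilbI commuting_tuple_def)
  interpret D1: dilation "ball 0 1" "\<lambda>z w. k (cdot z w)" HK E1 HK1 "\<lambda>i z. z $ i" 0 a c H T j1
    using unital_kernel_HK[OF assms(1,2,4,6,8)] D.op_tuple_axioms assms(11)
    by (simp add: dilation_def dilation_axioms_def minimal_K_dilation_def K_dilation_def Mz_eq_mul)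
  interpret D2: dilation "ball 0 1" "\<lambda>z w. k (cdot z w)" HK E2 HK2 "\<lambda>i z. z $ i" 0 a c H T j2
    using unital_kernel_HK[OF assms(1,2,4,7,9)] D.op_tuple_axioms assms(12)
    by (simp add: dilation_def dilation_axioms_def minimal_K_dilation_def K_dilation_def Mz_eq_mul)
  \<comment> \<open>Both sides are limits of the same sequence, which depends on \<open>T\<close>
    and \<open>c\<close> only.\<close>
  have ip_eq: "ip E1 (j1 x 0) (j1 y 0) = ip E2 (j2 x 0) (j2 y 0)" if "x \<in> carr H" "y \<in> carr H" for x y
    using LIMSEQ_unique[OF D1.ip_j_p[OF that] D2.ip_j_p[OF that]] .
  have in1: "j1 x z \<in> carr E1" and in2: "j2 x z \<in> carr E2" if "x \<in> carr H" for x z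
    using D1.value_in'[OF D1.j_in[OF that]] D2.value_in'[OF D2.j_in[OF that]] .
  have total1: "e = 0" if "e \<in> carr E1" "\<And>x. x \<in> carr H \<Longrightarrow> ip E1 (j1 x 0) e = 0" for e
    using assms(11) that
    by (intro D1.range_p_total_if_minimal) (auto simp: minimal_K_dilation_def Mz_eq_mul)
  have total2: "e = 0" if "e \<in> carr E2" "\<And>x. x \<in> carr H \<Longrightarrow> ip E2 (j2 x 0) e = 0" for e
    using assms(12) that
    by (intro D2.range_p_total_if_minimal) (auto simp: minimal_K_dilation_def Mz_eq_mul)
  obtain U where U: "unitary_op E1 E2 U" "\<And>x. x \<in> carr H \<Longrightarrow> U (j1 x 0) = j2 x 0"
    by (rule unitary_between_total_families[OF hilbI[OF assms(6)] hilbI[OF assms(7)] in1 in2 ip_eq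
          D1.csubspace_range_p D2.csubspace_range_p total1 total2]) blast+
  have iso: "isometric_op E1 E2 U" and surj: "U ` carr E1 = carr E2"
    using U(1) by (auto simp: unitary_op_def)
  note ip_U = isometric_ip[OF iso D1.E.inner_space_axioms D2.E.inner_space_axioms]
  have U_in: "U e \<in> carr E2" if "e \<in> carr E1" for e
    using surj that by blast
  \<comment> \<open>The slices of \<open>j1 x\<close> and \<open>j2 x\<close> lie in the same scalar
    space, so their difference can be tested there. Its words at 0 vanish because \<open>U\<close>
    carries \<open>j1 y 0\<close> to \<open>j2 y 0\<close> and preserves inner products.\<close>
  have slices: "slice E1 (j1 x) e = slice E2 (j2 x) (U e)" if x: "x \<in> carr H" and e: "e \<in> carr E1" for x e
  proof -
    note s1 = D1.slice_in[OF D1.j_in[OF x] e] and s2 = D2.slice_in[OF D2.j_in[OF x] U_in[OF e]]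
    have "slice E1 (j1 x) e - slice E2 (j2 x) (U e) = 0"
    proof (rule D1.eq_zero_if_adj_words_vanish)
      show "slice E1 (j1 x) e - slice E2 (j2 x) (U e) \<in> carr HK"
        by (rule D1.H.diff_in[OF s1 s2])
      fix I
      have y: "adj_word H T I x \<in> carr H"
        using x by simp
      have "ip E1 (j1 (adj_word H T I x) 0) e = ip E2 (j2 (adj_word H T I x) 0) (U e)"
        unfolding U(2)[OF y, symmetric] by (rule ip_U[OF in1[OF y] e, symmetric])
      then show "adj_word HK (\<lambda>i. mul (\<lambda>z. z $ i)) I (slice E1 (j1 x) e - slice E2 (j2 x) (U e)) 0 = 0"
        unfolding D1.HT.adj_word_diff[OF s1 s2]
        using D1.adj_word_slice_j[OF x e, of I] D2.adj_word_slice_j[OF x U_in[OF e], of I] by simp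
    qed
    then show ?thesis
      by (simp only: right_minus_eq)
  qed
  \<comment> \<open>By surjectivity every test vector is some \<open>U e\<close>, so equality of the
    slices determines the value of \<open>j2 x\<close>.\<close>
  have "j2 x z = U (j1 x z)" if x: "x \<in> carr H" for x z
  proof (rule D2.E.eqI_ip_left[OF in2[OF x] U_in[OF in1[OF x]]])
    fix u assume "u \<in> carr E2"
    then obtain e where e: "e \<in> carr E1" "u = U e"
      using surj by blast
    show "ip E2 (j2 x z) u = ip E2 (U (j1 x z)) u"
      using fun_cong[OF slices[OF x e(1)], of z] ip_U[OF in1[OF x] e(1)] by (simp add: slice_def e(2))
  qed
  then show ?thesis
    using U(1) by (auto simp: id_tensor_def fun_eq_iff)
qed

end
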